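(* Let $\sigma$ be an admissible weight on $\mathbb{D}$, let $\alpha>-1$, $0<p<\infty$, $t>\frac{2}{\alpha+2}$, and let $\Omega$ be the positive measure $d\Omega=\sigma\,dA$. Let $\psi\in\mathcal{H}(\mathbb{D})$, let $\varphi$ be an analytic self-map of $\mathbb{D}$, and suppose that the weighted composition operator $C_{\psi,\varphi}:A^p_\sigma\to L^p(\Omega)$ is bounded. Then the following statements are equivalent: (a) $C_{\psi,\varphi}$ is power bounded, that is, $Q_1=\sup_{n\in\mathbb{N}}\|C^n_{\psi,\varphi}\|^p<\infty$. (b) The sequence of functions $f_n(z)=\dfrac{\widetilde{\Omega}_{n,t}(z)}{\sigma(z)(1-|z|^2)^{2-\frac{(\alpha+2)t}{2}}}$, $z\in\mathbb{D}$, is norm bounded in $L^\infty(\mathbb{D})$, that is, $Q_2=\sup_{n\in\mathbb{N}}\|f_n\|_\infty<\infty$. (c) For some (equivalently, for any) $R\in(0,1)$, the sequence of functions $g_n(z)=\dfrac{\widehat{\Omega}_{n,R}(z)}{\sigma(z)}$, $z\in\mathbb{D}$, is norm bounded in $L^\infty(\mathbb{D})$, that is, $Q_3=\sup_{n\in\mathbb{N}}\|g_n\|_\infty<\infty$. (d) For some (equivalently, for any) $r$-lattice $\{z_k\}_{k=1}^\infty$ with fixed $r$, $0<r<1$, the double sequence $\gamma_{n,k}=\dfrac{\widehat{\Omega}_{n,r}(z_k)}{\sigma(z_k)}$ is bounded, that is, $Q_4=\sup_{n,k\in\mathbb{N}}\gamma_{n,k}<\infty$. Moreover, $Q_1\asymp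 Q_2\asymp Q_3\asymp Q_4$.
   Context: $\mathbb{D}=\{z\in\mathbb{C}:|z|<1\}$, $\mathcal{H}(\mathbb{D})$ is the space of analytic functions on $\mathbb{D}$, and $dA=\frac{dx\,dy}{\pi}$ is normalized area measure. A weight is a positive integrable function $\sigma\in C^2[0,1]$, extended to $\mathbb{D}$ by $\sigma(z)=\sigma(|z|)$. It is admissible if $\sigma$ is non-increasing on $[0,1)$ and $\sigma(r)(1-r)^{-(1+\delta)}$ is non-decreasing on $[0,1)$ for some $\delta>0$. For $0<p<\infty$, $A^p_\sigma=\{f\in\mathcal{H}(\mathbb{D}):\|f\|^p_{A^p_\sigma}=\int_{\mathbb{D}}|f|^p\sigma\,dA<\infty\}$. $\|\cdot\|_\infty$ is the essential supremum norm over $\mathbb{D}$. $C_{\psi,\varphi}f=\psi\,(f\circ\varphi)$. Let $\varphi_n$ denote the $n$-th iterate of $\varphi$ ($\varphi_0$ the identity). Then $C^n_{\psi,\varphi}f=\langle\psi,\varphi,n\rangle\, f\circ\varphi_n$ with $\langle\psi,\varphi,n\rangle=\prod_{j=0}^{n-1}\psi\circ\varphi_j$. Since $C_{\psi,\varphi}f$ is analytic and $d\Omega=\sigma\,dA$, the powers $C^n_{\psi,\varphi}$ act on $A^p_\sigma$, and $\|C^n_{\psi,\varphi}\|$ is the operator (quasi)norm there. Define the measure $\Omega_n$ on $\mathbb{D}$ by $\Omega_n(B)=\int_{\varphi_n^{-1}(B)}|\langle\psi,\varphi,n\rangle|^p\,d\Omega$ for Borel sets $B\subset\mathbb{D}$,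 so that $\|C^n_{\psi,\varphi}f\|^p_{L^p(\Omega)}=\int_{\mathbb{D}}|f|^p\,d\Omega_n$. For $a\in\mathbb{D}$ and $r\in(0,1)$, $E(a,r)=\{z\in\mathbb{D}:|\frac{a-z}{1-\bar a z}|<r\}$ is the pseudohyperbolic disk and $|E(a,r)|$ is its area. A sequence $\{z_k\}_{k=1}^\infty\subset\mathbb{D}$ is an $r$-lattice if the disks $E(z_k,r)$ cover $\mathbb{D}$ and there is an integer $M>0$ such that each $z\in\mathbb{D}$ belongs to at most $M$ of the disks $E(z_k,\frac{1+r}{2})$. For $\alpha>-1$, $K^\alpha(z,w)=(1-\bar w z)^{-(\alpha+2)}$, $k^\alpha_z(w)=K^\alpha(z,w)/\sqrt{K^\alpha(z,z)}$, $\widetilde{\Omega}_{n,t}(z)=\int_{\mathbb{D}}|k^\alpha_z(w)|^t\,d\Omega_n(w)$, and $\widehat{\Omega}_{n,r}(z)=\Omega_n(E(z,r))/|E(z,r)|$. $X\asymp Y$ means that $X$ is bounded above and below by positive constant multiples of $Y$, with constants independent of the variables involved (here independent of $\psi$ and $\varphi$). *)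

theory Defs
  imports "HOL-Complex_Analysis.Complex_Analysis" "HOL-Probability.Essential_Supremum"
begin

abbreviation disk :: "complex set" where
  "disk \<equiv> ball 0 1"

definition disk_area :: "complex measure" where
  "disk_area = density (restrict_space lborel disk) (\<lambda>_. ennreal (1 / pi))"

text \<open>A weight is given by its radial profile; its value at a point \<open>z\<close> of the disk is
  \<open>\<sigma> (cmod z)\<close>.\<close>

definition C2_unit_interval :: "(real \<Rightarrow> real) \<Rightarrow> bool" where
  "C2_unit_interval \<sigma> \<longleftrightarrow> (\<exists>\<sigma>' \<sigma>''.
     (\<forall>x\<in>{0..1}. (\<sigma> has_real_derivative \<sigma>' x) (at x within {0..1})) \<and>
     (\<forall>x\<in>{0..1}. (\<sigma>' has_real_derivative \<sigma>'' x) (at x within {0..1})) \<and>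
     continuous_on {0..1} \<sigma>'')"

text \<open>Positivity is required on the closed interval, where \<open>\<sigma>\<close> is defined, so \<open>\<sigma> 1 > 0\<close>.\<close>

definition weight :: "(real \<Rightarrow> real) \<Rightarrow> bool" where
  "weight \<sigma> \<longleftrightarrow>
     (\<forall>x\<in>{0..1}. 0 < \<sigma> x) \<and> set_integrable lborel {0..1} \<sigma> \<and> C2_unit_interval \<sigma>"

definition admissible_weight :: "(real \<Rightarrow> real) \<Rightarrow> bool" where
  "admissible_weight \<sigma> \<longleftrightarrow> weight \<sigma> \<and> antimono_on {0..<1} \<sigma> \<and>
     (\<exists>\<delta>>0. mono_on {0..<1} (\<lambda>x. \<sigma> x * (1 - x) powr (- (1 + \<delta>))))"

definition weight_measure :: "(real \<Rightarrow> real) \<Rightarrow> complex measure" where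
  "weight_measure \<sigma> = density disk_area (\<lambda>z. ennreal (\<sigma> (cmod z)))"

text \<open>Real powers of extended nonnegative reals, used for positive exponents only.\<close>

definition epowr :: "ennreal \<Rightarrow> real \<Rightarrow> ennreal" where
  "epowr x s = (if x = \<infinity> then \<infinity> else ennreal (enn2real x powr s))"

definition Lp_norm :: "real \<Rightarrow> complex measure \<Rightarrow> (complex \<Rightarrow> complex) \<Rightarrow> ennreal" where
  "Lp_norm p M f = epowr (\<integral>\<^sup>+z. ennreal (cmod (f z) powr p) \<partial>M) (1 / p)"

definition bergman_space :: "real \<Rightarrow> (real \<Rightarrow> real) \<Rightarrow> (complex \<Rightarrow> complex) set" where
  "bergman_space p \<sigma> = {f. f holomorphic_on disk \<and> Lp_norm p (weight_measure \<sigma>) f < \<infinity>}"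

text \<open>The operator (quasi)norm from the weighted Bergman space to \<open>L\<^sup>p\<close>, infinite for an
  unbounded operator.\<close>

definition op_norm ::
  "real \<Rightarrow> (real \<Rightarrow> real) \<Rightarrow> ((complex \<Rightarrow> complex) \<Rightarrow> complex \<Rightarrow> complex) \<Rightarrow> ennreal" where
  "op_norm p \<sigma> T =
     (SUP f\<in>{f \<in> bergman_space p \<sigma>. Lp_norm p (weight_measure \<sigma>) f \<le> 1}.
        Lp_norm p (weight_measure \<sigma>) (T f))"

definition bounded_op ::
  "real \<Rightarrow> (real \<Rightarrow> real) \<Rightarrow> ((complex \<Rightarrow> complex) \<Rightarrow> complex \<Rightarrow> complex) \<Rightarrow> bool" where
  "bounded_op p \<sigma> T \<longleftrightarrow> (\<exists>B\<ge>0. \<forall>f\<in>bergman_space p \<sigma>.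
     Lp_norm p (weight_measure \<sigma>) (T f) \<le> ennreal B * Lp_norm p (weight_measure \<sigma>) f)"

definition wcomp ::
  "(complex \<Rightarrow> complex) \<Rightarrow> (complex \<Rightarrow> complex) \<Rightarrow> (complex \<Rightarrow> complex) \<Rightarrow> complex \<Rightarrow> complex" where
  "wcomp \<psi> \<phi> f = (\<lambda>z. \<psi> z * f (\<phi> z))"

definition bounded_wcomp ::
  "real \<Rightarrow> (real \<Rightarrow> real) \<Rightarrow> (complex \<Rightarrow> complex) \<Rightarrow> (complex \<Rightarrow> complex) \<Rightarrow> bool" where
  "bounded_wcomp p \<sigma> \<psi> \<phi> \<longleftrightarrow>
     \<psi> holomorphic_on disk \<and> \<phi> holomorphic_on disk \<and> \<phi> ` disk \<subseteq> disk \<and>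
     bounded_op p \<sigma> (wcomp \<psi> \<phi>)"

definition weight_cocycle ::
  "(complex \<Rightarrow> complex) \<Rightarrow> (complex \<Rightarrow> complex) \<Rightarrow> nat \<Rightarrow> complex \<Rightarrow> complex" where
  "weight_cocycle \<psi> \<phi> n z = (\<Prod>j<n. \<psi> ((\<phi> ^^ j) z))"

definition iterate_measure ::
  "real \<Rightarrow> (real \<Rightarrow> real) \<Rightarrow> (complex \<Rightarrow> complex) \<Rightarrow> (complex \<Rightarrow> complex) \<Rightarrow> nat \<Rightarrow> complex measure" where
  "iterate_measure p \<sigma> \<psi> \<phi> n =
     distr (density (weight_measure \<sigma>) (\<lambda>z. ennreal (cmod (weight_cocycle \<psi> \<phi> n z) powr p)))
       (restrict_space borel disk) (\<phi> ^^ n)"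

definition pseudo_disk :: "complex \<Rightarrow> real \<Rightarrow> complex set" where
  "pseudo_disk a r = {z \<in> disk. cmod ((a - z) / (1 - cnj a * z)) < r}"

definition is_lattice :: "real \<Rightarrow> (nat \<Rightarrow> complex) \<Rightarrow> bool" where
  "is_lattice r z \<longleftrightarrow> range z \<subseteq> disk \<and> disk \<subseteq> (\<Union>k. pseudo_disk (z k) r) \<and>
     (\<exists>M::nat. 0 < M \<and> (\<forall>w\<in>disk.
        finite {k. w \<in> pseudo_disk (z k) ((1 + r) / 2)} \<and>
        card {k. w \<in> pseudo_disk (z k) ((1 + r) / 2)} \<le> M))"

text \<open>For \<open>z\<close> and \<open>w\<close> in the disk, \<open>1 - cnj w * z\<close> lies in the right half-plane, so the
  principal power is the analytic branch equal to 1 at \<open>z = 0\<close>.\<close>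

definition bergman_kernel :: "real \<Rightarrow> complex \<Rightarrow> complex \<Rightarrow> complex" where
  "bergman_kernel \<alpha> z w = (1 - cnj w * z) powr (- of_real (\<alpha> + 2))"

definition normalized_kernel :: "real \<Rightarrow> complex \<Rightarrow> complex \<Rightarrow> complex" where
  "normalized_kernel \<alpha> z w = bergman_kernel \<alpha> z w / csqrt (bergman_kernel \<alpha> z z)"

definition berezin :: "real \<Rightarrow> real \<Rightarrow> complex measure \<Rightarrow> complex \<Rightarrow> ennreal" where
  "berezin \<alpha> t \<mu> z = (\<integral>\<^sup>+w. ennreal (cmod (normalized_kernel \<alpha> z w) powr t) \<partial>\<mu>)"

definition averaging :: "real \<Rightarrow> complex measure \<Rightarrow> complex \<Rightarrow> ennreal" where
  "averaging r \<mu> z = emeasure \<mu> (pseudo_disk z r) / emeasure disk_area (pseudo_disk z r)"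

text \<open>The four quantities take values in \<open>[0, \<infinity>]\<close>; suprema run over \<open>n \<ge> 1\<close>.\<close>

definition Q1 :: "real \<Rightarrow> (real \<Rightarrow> real) \<Rightarrow> (complex \<Rightarrow> complex) \<Rightarrow> (complex \<Rightarrow> complex) \<Rightarrow> ennreal" where
  "Q1 p \<sigma> \<psi> \<phi> = (SUP n\<in>{1..}. epowr (op_norm p \<sigma> (wcomp \<psi> \<phi> ^^ n)) p)"

definition Q2 :: "real \<Rightarrow> real \<Rightarrow> real \<Rightarrow> (real \<Rightarrow> real) \<Rightarrow>
    (complex \<Rightarrow> complex) \<Rightarrow> (complex \<Rightarrow> complex) \<Rightarrow> ennreal" where
  "Q2 \<alpha> t p \<sigma> \<psi> \<phi> = (SUP n\<in>{1..}. esssup disk_area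
     (\<lambda>z. berezin \<alpha> t (iterate_measure p \<sigma> \<psi> \<phi> n) z /
          ennreal (\<sigma> (cmod z) * (1 - (cmod z)\<^sup>2) powr (2 - (\<alpha> + 2) * t / 2))))"

definition Q3 :: "real \<Rightarrow> real \<Rightarrow> (real \<Rightarrow> real) \<Rightarrow>
    (complex \<Rightarrow> complex) \<Rightarrow> (complex \<Rightarrow> complex) \<Rightarrow> ennreal" where
  "Q3 R p \<sigma> \<psi> \<phi> = (SUP n\<in>{1..}. esssup disk_area
     (\<lambda>z. averaging R (iterate_measure p \<sigma> \<psi> \<phi> n) z / ennreal (\<sigma> (cmod z))))"

definition Q4 :: "real \<Rightarrow> (nat \<Rightarrow> complex) \<Rightarrow> real \<Rightarrow> (real \<Rightarrow> real) \<Rightarrow>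
    (complex \<Rightarrow> complex) \<Rightarrow> (complex \<Rightarrow> complex) \<Rightarrow> ennreal" where
  "Q4 r z p \<sigma> \<psi> \<phi> = (SUP n\<in>{1..}. SUP k.
     averaging r (iterate_measure p \<sigma> \<psi> \<phi> n) (z k) / ennreal (\<sigma> (cmod (z k))))"

text \<open>Two-sided comparison with one constant for all pairs \<open>(\<psi>, \<phi>)\<close> satisfying \<open>H\<close>. Both sides
  may be infinite.\<close>

definition uniformly_comparable ::
  "('a \<Rightarrow> 'b \<Rightarrow> bool) \<Rightarrow> ('a \<Rightarrow> 'b \<Rightarrow> ennreal) \<Rightarrow> ('a \<Rightarrow> 'b \<Rightarrow> ennreal) \<Rightarrow> bool" where
  "uniformly_comparable H X Y \<longleftrightarrow> (\<exists>C::real. C > 0 \<and>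
     (\<forall>\<psi> \<phi>. H \<psi> \<phi> \<longrightarrow> X \<psi> \<phi> \<le> ennreal C * Y \<psi> \<phi> \<and> Y \<psi> \<phi> \<le> ennreal C * X \<psi> \<phi>))"

end

theory Submission
  imports Defs
begin

text \<open>All four quantities measure how well the Bergman space embeds into \<open>L\<^sup>p\<close> of the measures
\<open>\<Omega>\<^sub>n\<close> (\<open>iterate_measure\<close>): since \<open>\<integral>|C\<^sup>n f|\<^sup>p d\<Omega> = \<integral>|f|\<^sup>p d\<Omega>\<^sub>n\<close>, the number
\<open>\<parallel>C\<^sup>n\<parallel>\<^sup>p\<close> is the best constant in the Carleson inequality
\<open>\<integral>|f|\<^sup>p d\<mu> \<le> A \<integral>|f|\<^sup>p d\<Omega>\<close> for \<open>\<mu> = \<Omega>\<^sub>n\<close>. So it is enough to compare, for one finite measure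
\<open>\<mu>\<close> and with constants independent of \<open>\<mu>\<close>, the Carleson constant, the normalized Berezin
transform, the averages over pseudohyperbolic disks, and the averages over a lattice. A weight is
continuous and positive on the closed unit interval, hence lies between two positive constants,
and can be traded for area measure at the cost of a constant.

Three links form a cycle. Testing the Carleson inequality on negative powers of
\<open>1 - cnj z * w\<close> bounds the Berezin transform at every point by the Carleson constant
(\<open>normalized_berezin_le_carleson_const\<close>); this needs the size of \<open>\<integral>|1 - cnj z * w|\<^sup>-\<^sup>s dA(w)\<close> for
\<open>s = (\<alpha> + 2) * t > 2\<close>, which is where the condition on \<open>t\<close> enters
(\<open>disk_kernel_integral_bound\<close>). On a pseudohyperbolic disk around \<open>z\<close> the modulus
\<open>|1 - cnj z * w|\<close> is at most a multiple of \<open>1 - |z|\<close>, so the Berezin transform dominates the averages pointwise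
(\<open>normalized_average_le_berezin\<close>). Finally \<open>|f|\<^sup>p\<close> satisfies, up to a constant, a sub-mean-value inequality
on disks (\<open>disk_power_bound\<close>); integrating it against \<open>\<mu>\<close> and exchanging the order of integration turns the
averages into a bound for the Carleson constant (\<open>power_integral_le_averages\<close>).

The lattice averages are particular averages, hence bounded by the Carleson constant; conversely
the sub-mean-value inequality on each lattice disk, together with the bounded overlap of the
enlarged disks, gives the Carleson inequality back (\<open>power_integral_le_lattice_averages\<close>). The
existential form of the lattice condition also requires that lattices exist
(\<open>exists_lattice\<close>).

All links hold for every exponent \<open>p > 0\<close>. The sub-mean-value inequality for small \<open>p\<close> comes
from Cauchy's formula for a power \<open>f\<^sup>m\<close> with an integer \<open>m \<ge> p\<close> by a maximum argument
(\<open>area_power_bound\<close>).\<close>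

section \<open>Sub-mean-value inequalities for powers of holomorphic functions\<close>

text \<open>Cauchy's formula on a circle that need not be centred at \<open>a\<close>: the circle stays at distance at
least \<open>\<rho> / 2\<close> from \<open>a\<close>, so the Cauchy kernel is at most \<open>2 / \<rho>\<close> on it. The freedom in the centre
makes it possible to average over \<open>c\<close> afterwards.\<close>

lemma circle_average_bound:
  assumes "f holomorphic_on ball a (2 * \<rho>)" "\<rho> > 0" "c \<in> ball a (\<rho> / 2)"
  shows "ennreal (cmod (f a)) \<le> 2 * (\<integral>\<^sup>+t. ennreal (cmod (f (c + of_real \<rho> * exp (2 * of_real pi * \<i> * of_real t)))) * indicator {0..1} t \<partial>lborel)"
proof -
  define e :: "real \<Rightarrow> complex" where "e t = exp (2 * of_real pi * \<i> * of_real t)" for t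
  have sub: "cball c \<rho> \<subseteq> ball a (2 * \<rho>)"
  proof
    fix x assume "x \<in> cball c \<rho>"
    then show "x \<in> ball a (2 * \<rho>)"
      using assms(2,3) dist_triangle[of a x c] by auto
  qed
  have e1: "cmod (e t) = 1" for t by (simp add: e_def)
  have on: "c + of_real \<rho> * e t \<in> cball c \<rho>" for t
    using assms(2) by (simp add: dist_norm norm_mult e1)
  have cf: "continuous_on (cball c \<rho>) f"
    using holomorphic_on_imp_continuous_on[OF assms(1)] sub continuous_on_subset by blast
  have hf: "f holomorphic_on ball c \<rho>"
    using assms(1) sub holomorphic_on_subset[OF assms(1)] by (meson ball_subset_cball order_trans)
  have ain: "cmod (a - c) < \<rho>" using assms(2,3) by (simp add: dist_norm)
  define h where "h t = cmod (f (c + of_real \<rho> * e t))" for t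
  have conth: "continuous_on {0..1} h"
    unfolding h_def
    by (intro continuous_on_norm continuous_on_compose2[OF cf])
       (use on in \<open>auto simp: e_def intro!: continuous_intros\<close>)
  define g where "g t = f (circlepath c \<rho> t) / (circlepath c \<rho> t - a) *
      vector_derivative (circlepath c \<rho>) (at t within {0..1})" for t
  have gi: "(g has_integral 2 * of_real pi * \<i> * f a) {0..1}"
    using Cauchy_integral_circlepath[OF cf hf ain]
    unfolding has_contour_integral_def g_def by simp
  have bnd: "cmod (g t) \<le> 4 * pi * h t" if t: "t \<in> {0..1}" for t
  proof -
    have vd: "vector_derivative (circlepath c \<rho>) (at t within {0..1}) = 2 * of_real pi * \<i> * \<rho> * e t"
      using t by (simp add: vector_derivative_circlepath01 e_def)
    have far: "\<rho> / 2 \<le> cmod (c + of_real \<rho> * e t - a)"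
    proof -
      have "\<rho> = cmod (of_real \<rho> * e t)" using assms(2) by (simp add: norm_mult e1)
      also have "\<dots> \<le> cmod (c + of_real \<rho> * e t - a) + cmod (a - c)"
        by (rule order_trans[OF _ norm_triangle_ineq]) (simp add: algebra_simps)
      also have "cmod (a - c) \<le> \<rho> / 2" using assms(3) by (simp add: dist_norm)
      finally show ?thesis by simp
    qed
    then have pos: "0 < cmod (c + of_real \<rho> * e t - a)" using assms(2) by linarith
    have "cmod (g t) = h t / cmod (c + of_real \<rho> * e t - a) * (2 * pi * \<rho>)"
      unfolding g_def vd using assms(2)
      by (simp add: circlepath e_def[symmetric] h_def norm_mult norm_divide e1)
    also have "\<dots> \<le> h t / (\<rho> / 2) * (2 * pi * \<rho>)"
      using far assms(2) pos by (intro mult_right_mono divide_left_mono mult_pos_pos) (auto simp: h_def)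
    also have "\<dots> = 4 * pi * h t" using assms(2) by simp
    finally show ?thesis .
  qed
  have hint: "h integrable_on {0..1}" using conth by (rule integrable_continuous_interval)
  have "cmod (integral {0..1} g) \<le> integral {0..1} (\<lambda>t. 4 * pi * h t)"
    by (rule integral_norm_bound_integral) (use gi hint bnd in auto)
  then have "2 * pi * cmod (f a) \<le> 4 * pi * integral {0..1} h"
    using gi by (simp add: integral_unique norm_mult)
  then have le: "cmod (f a) \<le> 2 * integral {0..1} h" using pi_gt_zero by simp
  have bm: "(\<lambda>t. indicator {0..1} t *\<^sub>R h t) \<in> borel_measurable borel"
    using conth by (rule borel_measurable_continuous_on_indicator[rotated]) simp
  have "(\<integral>\<^sup>+t. ennreal (h t) * indicator {0..1} t \<partial>lborel) = ennreal (integral {0..1} h)"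
  proof -
    have "((\<lambda>t. indicator {0..1} t *\<^sub>R h t) has_integral integral {0..1} h) UNIV"
    proof -
      have "(\<lambda>t. indicator {0..1} t *\<^sub>R h t) = (\<lambda>t. if t \<in> {0..1} then h t else 0)"
        by (auto simp: indicator_def)
      then show ?thesis using integrable_integral[OF hint] by (simp only: has_integral_restrict_UNIV)
    qed
    then have "(\<integral>\<^sup>+t. ennreal (indicator {0..1} t *\<^sub>R h t) \<partial>lborel) = ennreal (integral {0..1} h)"
      by (intro nn_integral_has_integral_lborel) (use bm in \<open>auto simp: h_def\<close>)
    moreover have "ennreal (indicator {0..1} t *\<^sub>R h t) = ennreal (h t) * indicator {0..1} t" for t
      by (auto simp: indicator_def)
    ultimately show ?thesis by simp
  qed
  then show ?thesis
    using le unfolding h_def e_def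
    by (metis ennreal_leI ennreal_mult' ennreal_numeral zero_le_numeral)
qed

text \<open>Averaging the previous bound over the centres \<open>c\<close> of \<open>ball a (\<rho> / 2)\<close> replaces the circle by an area
integral: for each fixed angle the points of the circles form a translate of that ball, so after
exchanging the integrals translation invariance of Lebesgue measure finishes the proof.\<close>

lemma area_mean_bound:
  assumes "f holomorphic_on ball a (2 * \<rho>)" "\<rho> > 0"
  shows "ennreal (\<rho>\<^sup>2 * cmod (f a)) \<le> 8 / pi * (\<integral>\<^sup>+u. ennreal (cmod (f u)) * indicator (ball a (2 * \<rho>)) u \<partial>lborel)"
proof -
  define v :: "real \<Rightarrow> complex" where "v t = of_real \<rho> * exp (2 * of_real pi * \<i> * of_real t)" for t
  define F where "F u = ennreal (cmod (f u)) * indicator (ball a (2 * \<rho>)) u" for u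
  have [measurable]: "v \<in> borel_measurable borel"
    unfolding v_def by (intro borel_measurable_continuous_onI continuous_intros)
  have v1: "cmod (v t) = \<rho>" for t using assms(2) by (simp add: v_def norm_mult)
  have "(\<lambda>u. indicator (ball a (2 * \<rho>)) u *\<^sub>R cmod (f u)) \<in> borel_measurable borel"
    by (intro borel_measurable_continuous_on_indicator continuous_on_norm
         holomorphic_on_imp_continuous_on assms(1)) simp
  moreover have "F = (\<lambda>u. ennreal (indicator (ball a (2 * \<rho>)) u *\<^sub>R cmod (f u)))"
    by (auto simp: F_def indicator_def fun_eq_iff)
  ultimately have Fm [measurable]: "F \<in> borel_measurable borel" by simp
  have pt: "ennreal (cmod (f a)) * indicator (ball a (\<rho> / 2)) c \<le>
      2 * (\<integral>\<^sup>+t. F (c + v t) * indicator {0..1} t \<partial>lborel)" for c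
  proof (cases "c \<in> ball a (\<rho> / 2)")
    case True
    have "c + v t \<in> ball a (2 * \<rho>)" for t
    proof -
      have "dist a (c + v t) \<le> dist a c + dist c (c + v t)" by (rule dist_triangle)
      also have "\<dots> < 2 * \<rho>" using True assms(2) by (simp add: dist_norm v1)
      finally show ?thesis by simp
    qed
    then show ?thesis
      using circle_average_bound[OF assms True] True by (simp add: F_def v_def)
  qed simp
  have vol: "emeasure lborel (ball a (\<rho> / 2)) = ennreal (pi * (\<rho> / 2)\<^sup>2)"
    using assms(2) by (simp add: emeasure_ball unit_ball_vol_2 DIM_complex)
  have "ennreal (cmod (f a)) * ennreal (pi * (\<rho> / 2)\<^sup>2) =
      (\<integral>\<^sup>+c. ennreal (cmod (f a)) * indicator (ball a (\<rho> / 2)) c \<partial>lborel)"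
    by (simp add: nn_integral_cmult_indicator vol)
  also have "\<dots> \<le> (\<integral>\<^sup>+c. 2 * (\<integral>\<^sup>+t. F (c + v t) * indicator {0..1} t \<partial>lborel) \<partial>lborel)"
    by (intro nn_integral_mono pt)
  also have "\<dots> = 2 * (\<integral>\<^sup>+c. (\<integral>\<^sup>+t. F (c + v t) * indicator {0..1} t \<partial>lborel) \<partial>lborel)"
    by (rule nn_integral_cmult) measurable
  also have "(\<integral>\<^sup>+c. (\<integral>\<^sup>+t. F (c + v t) * indicator {0..1} t \<partial>lborel) \<partial>lborel) =
      (\<integral>\<^sup>+t. (\<integral>\<^sup>+c. F (c + v t) * indicator {0..1} t \<partial>lborel) \<partial>lborel)"
    by (rule lborel_pair.Fubini') measurable
  also have "\<dots> = (\<integral>\<^sup>+t. integral\<^sup>N lborel F * indicator {0..1::real} t \<partial>lborel)"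
  proof (intro nn_integral_cong)
    fix t :: real
    have "(\<integral>\<^sup>+c. F (c + v t) \<partial>lborel) = (\<integral>\<^sup>+u. F u \<partial>distr lborel borel ((+) (v t)))"
      by (simp add: nn_integral_distr add.commute)
    also have "\<dots> = integral\<^sup>N lborel F" by (simp add: lborel_distr_plus)
    finally show "(\<integral>\<^sup>+c. F (c + v t) * indicator {0..1} t \<partial>lborel) =
        integral\<^sup>N lborel F * indicator {0..1} t"
      by (simp add: nn_integral_multc)
  qed
  also have "\<dots> = integral\<^sup>N lborel F" by (simp add: nn_integral_cmult)
  finally have "ennreal (cmod (f a)) * ennreal (pi * (\<rho> / 2)\<^sup>2) \<le> 2 * integral\<^sup>N lborel F" .
  then have "ennreal (4 / pi) * (ennreal (cmod (f a)) * ennreal (pi * (\<rho> / 2)\<^sup>2)) \<le>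
      ennreal (4 / pi) * (2 * integral\<^sup>N lborel F)"
    by (rule mult_left_mono) simp
  moreover have "ennreal (4 / pi) * (ennreal (cmod (f a)) * ennreal (pi * (\<rho> / 2)\<^sup>2)) = ennreal (\<rho>\<^sup>2 * cmod (f a))"
    by (simp add: ennreal_mult'[symmetric] power2_eq_square)
  moreover have "ennreal (4 / pi) * (2 * integral\<^sup>N lborel F) = ennreal (8 / pi) * integral\<^sup>N lborel F"
  proof -
    have "ennreal (4 / pi) * 2 = ennreal (8 / pi)"
      by (metis ennreal_mult' ennreal_numeral times_divide_eq_left mult_2_right numeral_Bit0 zero_le_numeral mult.commute)
    then show ?thesis by (simp add: mult.assoc[symmetric])
  qed
  ultimately show ?thesis by (simp add: F_def[abs_def])
qed

text \<open>For \<open>p < 1\<close> the inequality does not follow from convexity. Instead, let \<open>w0\<close> maximize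
\<open>(\<rho>1 - |w - a|)\<^sup>2 |f w|\<^sup>p\<close> over a closed disk, and let \<open>d\<close> be the distance from \<open>w0\<close> to its
boundary. On \<open>ball w0 (d / 2)\<close> the first factor is at least a quarter of its value at \<open>w0\<close>, so
\<open>|f|\<^sup>p \<le> 4 |f w0|\<^sup>p\<close> there. The area bound for \<open>f\<^sup>m\<close> with an integer \<open>m \<ge> p\<close> then controls
\<open>|f w0|\<^sup>m\<close> by \<open>|f w0|\<^sup>m\<^sup>-\<^sup>p \<integral>|f|\<^sup>p\<close>; cancelling gives the estimate at \<open>w0\<close>, and maximality
transports it to \<open>a\<close>.\<close>

lemma area_power_bound:
  fixes p :: real
  assumes p: "p > 0"
  obtains K :: real where "K > 0"
    "\<And>f a \<rho>. f holomorphic_on ball a \<rho> \<Longrightarrow> \<rho> > 0 \<Longrightarrow>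
       ennreal (\<rho>\<^sup>2 * cmod (f a) powr p) \<le>
         ennreal K * (\<integral>\<^sup>+u. ennreal (cmod (f u) powr p) * indicator (ball a \<rho>) u \<partial>lborel)"
proof -
  define m where "m = nat \<lceil>p\<rceil>"
  have m: "p \<le> real m" "m \<ge> 1" using p unfolding m_def by linarith+
  \<comment> \<open>The bound 4 for \<open>|f w|\<^sup>p / |f w0|\<^sup>p\<close>, raised to the power \<open>(m - p) / p\<close>.\<close>
  define c0 :: real where "c0 = 4 powr ((real m - p) / p)"
  have c0: "c0 > 0" by (simp add: c0_def)
  define K where "K = 64 * (8 / pi) * c0"
  have "ennreal (\<rho>\<^sup>2 * cmod (f a) powr p) \<le>
         ennreal K * (\<integral>\<^sup>+u. ennreal (cmod (f u) powr p) * indicator (ball a \<rho>) u \<partial>lborel)" 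
    (is "_ \<le> ennreal K * ?I")
    if hol: "f holomorphic_on ball a \<rho>" and \<rho>: "\<rho> > 0" for f a \<rho>
  proof -
    define \<rho>1 where "\<rho>1 = \<rho> / 2"
    have \<rho>1: "\<rho>1 > 0" "\<rho>1 < \<rho>" using \<rho> by (auto simp: \<rho>1_def)
    define F where "F w = (\<rho>1 - cmod (w - a))\<^sup>2 * cmod (f w) powr p" for w
    have contf: "continuous_on (cball a \<rho>1) f"
      using \<rho>1 by (intro continuous_on_subset[OF holomorphic_on_imp_continuous_on[OF hol]])
         (simp add: cball_subset_ball_iff)
    have "continuous_on (cball a \<rho>1) F"
      unfolding F_def using p by (intro continuous_intros continuous_on_powr' contf) auto
    then obtain w0 where w0: "w0 \<in> cball a \<rho>1" and max: "\<And>w. w \<in> cball a \<rho>1 \<Longrightarrow> F w \<le> F w0"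
      using continuous_attains_sup[of "cball a \<rho>1" F] \<rho>1 by auto
    have Fa: "\<rho>1\<^sup>2 * cmod (f a) powr p \<le> F w0"
      using max[of a] \<rho>1 by (simp add: F_def)
    show ?thesis
    proof (cases "F w0 = 0")
      case True
      then have "cmod (f a) powr p \<le> 0" using Fa \<rho>1 by (simp add: mult_le_0_iff)
      then have "f a = 0" by simp
      then show ?thesis by simp
    next
      case False
      define d where "d = \<rho>1 - cmod (w0 - a)"
      have d: "d > 0" and f0: "f w0 \<noteq> 0"
        using False w0 by (auto simp: F_def d_def dist_norm norm_minus_commute less_le)
      have Fw0: "F w0 = d\<^sup>2 * cmod (f w0) powr p" by (simp add: F_def d_def)
      have sub: "ball w0 (d / 2) \<subseteq> ball a \<rho>"
      proof
        fix w assume "w \<in> ball w0 (d / 2)"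
        then have "cmod (w - a) < \<rho>1 - d / 2"
          using norm_triangle_ineq[of "w - w0" "w0 - a"] by (simp add: d_def dist_norm norm_minus_commute field_simps)
        then show "w \<in> ball a \<rho>" using d \<rho>1 by (simp add: dist_norm norm_minus_commute)
      qed
      have pt: "cmod (f w) ^ m \<le> c0 * cmod (f w0) powr (real m - p) * cmod (f w) powr p"
        if w: "w \<in> ball w0 (d / 2)" for w
      proof (cases "f w = 0")
        case True then show ?thesis using m(2) c0 by (auto simp: power_0_left)
      next
        case False
        have near: "\<rho>1 - cmod (w - a) \<ge> d / 2"
          using w norm_triangle_ineq[of "w - w0" "w0 - a"] by (simp add: d_def dist_norm norm_minus_commute)
        have "(d / 2)\<^sup>2 * cmod (f w) powr p \<le> F w"
          unfolding F_def using near d by (intro mult_right_mono power_mono) auto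
        also have "\<dots> \<le> d\<^sup>2 * cmod (f w0) powr p"
          using max[of w] near d Fw0 by (simp add: dist_norm norm_minus_commute)
        finally have "cmod (f w) powr p \<le> 4 * cmod (f w0) powr p"
          using d by (simp add: power_divide)
        then have "(cmod (f w) powr p) powr ((real m - p) / p) \<le> (4 * cmod (f w0) powr p) powr ((real m - p) / p)"
          using m p by (intro powr_mono2) auto
        then have "cmod (f w) powr (real m - p) \<le> c0 * cmod (f w0) powr (real m - p)"
          using p by (simp add: powr_powr powr_mult c0_def)
        then have "cmod (f w) powr (real m - p) * cmod (f w) powr p \<le>
             c0 * cmod (f w0) powr (real m - p) * cmod (f w) powr p"
          by (rule mult_right_mono) simp
        moreover have "cmod (f w) powr (real m - p) * cmod (f w) powr p = cmod (f w) ^ m"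
          using False by (simp add: powr_add[symmetric] powr_realpow)
        ultimately show ?thesis by simp
      qed
      define y where "y = cmod (f w0) powr (real m - p)"
      have y: "y > 0" using f0 by (simp add: y_def)
      have "(\<lambda>u. f u ^ m) holomorphic_on ball w0 (2 * (d / 4))"
        using hol sub by (intro holomorphic_intros) (auto intro: holomorphic_on_subset)
      from area_mean_bound[OF this] d
      have "ennreal ((d / 4)\<^sup>2 * cmod (f w0) ^ m) \<le>
          ennreal (8 / pi) * (\<integral>\<^sup>+u. ennreal (cmod (f u) ^ m) * indicator (ball w0 (d / 2)) u \<partial>lborel)"
        by (simp add: norm_power)
      also have "(\<integral>\<^sup>+u. ennreal (cmod (f u) ^ m) * indicator (ball w0 (d / 2)) u \<partial>lborel) \<le>
          (\<integral>\<^sup>+u. ennreal (c0 * y) * (ennreal (cmod (f u) powr p) * indicator (ball a \<rho>) u) \<partial>lborel)"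
        using pt sub c0 y
        by (intro nn_integral_mono) (auto simp: indicator_def ennreal_mult'[symmetric] y_def intro!: ennreal_leI)
      also have "\<dots> = ennreal (c0 * y) * ?I"
      proof (rule nn_integral_cmult)
        have "(\<lambda>u. indicator (ball a \<rho>) u *\<^sub>R (cmod (f u) powr p)) \<in> borel_measurable borel"
          using p by (intro borel_measurable_continuous_on_indicator continuous_on_powr' continuous_on_norm
               holomorphic_on_imp_continuous_on hol continuous_intros) auto
        moreover have "ennreal (cmod (f u) powr p) * indicator (ball a \<rho>) u =
            ennreal (indicator (ball a \<rho>) u *\<^sub>R (cmod (f u) powr p))" for u
          by (auto simp: indicator_def)
        ultimately show "(\<lambda>u. ennreal (cmod (f u) powr p) * indicator (ball a \<rho>) u) \<in> borel_measurable lborel"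
          by simp
      qed
      finally have "ennreal ((d / 4)\<^sup>2 * cmod (f w0) ^ m) \<le> ennreal (8 / pi) * (ennreal (c0 * y) * ?I)"
        by (simp add: mult_left_mono)
      moreover have "ennreal (8 / pi * (c0 * y)) = ennreal (8 / pi) * ennreal (c0 * y)"
        by (rule ennreal_mult') simp
      ultimately have step: "ennreal ((d / 4)\<^sup>2 * cmod (f w0) ^ m) \<le> ennreal (8 / pi * (c0 * y)) * ?I"
        by (simp only: mult.assoc)
      have split: "cmod (f w0) ^ m = cmod (f w0) powr p * y"
        using f0 by (simp add: y_def powr_add[symmetric] powr_realpow)
      have "ennreal (\<rho>\<^sup>2 * cmod (f a) powr p) \<le> ennreal (4 * F w0)"
        using Fa by (intro ennreal_leI) (simp add: \<rho>1_def power_divide)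
      also have "4 * F w0 = (64 / y) * ((d / 4)\<^sup>2 * cmod (f w0) ^ m)"
        using y by (simp add: Fw0 split power_divide)
      also have "ennreal \<dots> = ennreal (64 / y) * ennreal ((d / 4)\<^sup>2 * cmod (f w0) ^ m)"
        by (rule ennreal_mult') (use y in simp)
      also have "\<dots> \<le> ennreal (64 / y) * (ennreal (8 / pi * (c0 * y)) * ?I)"
        by (rule mult_left_mono[OF step]) simp
      also have "\<dots> = ennreal ((64 / y) * (8 / pi * (c0 * y))) * ?I"
        by (subst ennreal_mult'[of "64 / y"]) (use y in \<open>simp_all only: mult.assoc, simp\<close>)
      also have "(64 / y) * (8 / pi * (c0 * y)) = K"
        using y by (simp add: K_def)
      finally show ?thesis .
    qed
  qed
  moreover have "K > 0" using c0 by (simp add: K_def)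
  ultimately show ?thesis using that by blast
qed

section \<open>Geometry of pseudohyperbolic disks\<close>

text \<open>This follows from
\<open>|1 - cnj z * w|\<^sup>2 - |z - w|\<^sup>2 = (1 - |z|\<^sup>2) (1 - |w|\<^sup>2) \<ge> 0\<close>.\<close>

lemma dist_le_norm_one_minus_cnj:
  assumes "z \<in> disk" "w \<in> disk"
  shows "cmod (z - w) \<le> cmod (1 - cnj z * w)"
proof -
  have id: "(cmod (1 - cnj z * w))\<^sup>2 - (cmod (z - w))\<^sup>2 = (1 - (cmod z)\<^sup>2) * (1 - (cmod w)\<^sup>2)"
    unfolding cmod_power2 by (simp add: power2_eq_square algebra_simps)
  have "(cmod z)\<^sup>2 \<le> 1" "(cmod w)\<^sup>2 \<le> 1"
    using assms by (auto simp: abs_square_le_1)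
  then have "(cmod (z - w))\<^sup>2 \<le> (cmod (1 - cnj z * w))\<^sup>2"
    using id mult_nonneg_nonneg[of "1 - (cmod z)\<^sup>2" "1 - (cmod w)\<^sup>2"] by linarith
  then show ?thesis by (rule power2_le_imp_le) simp
qed

lemma one_minus_norm_le:
  assumes "z \<in> disk" "w \<in> disk"
  shows "1 - cmod z \<le> cmod (1 - cnj z * w)" "1 - cmod w \<le> cmod (1 - cnj z * w)"
proof -
  have *: "1 - cmod z * cmod w \<le> cmod (1 - cnj z * w)"
    using norm_triangle_ineq2[of 1 "cnj z * w"] by (simp add: norm_mult)
  have "cmod z * cmod w \<le> cmod z * 1" "cmod z * cmod w \<le> 1 * cmod w"
    using assms by (intro mult_left_mono mult_right_mono; simp)+
  then show "1 - cmod z \<le> cmod (1 - cnj z * w)" "1 - cmod w \<le> cmod (1 - cnj z * w)"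
    using * by simp_all
qed

text \<open>The reason is \<open>1 - cnj z * w = (1 - |z|\<^sup>2) + cnj z * (z - w)\<close>.\<close>

lemma norm_one_minus_cnj_le:
  assumes "z \<in> disk"
  shows "cmod (1 - cnj z * w) \<le> 2 * (1 - cmod z) + cmod (z - w)"
proof -
  have "1 - cnj z * w = of_real (1 - (cmod z)\<^sup>2) + cnj z * (z - w)"
    using complex_norm_square[of z] by (simp add: algebra_simps)
  then have "cmod (1 - cnj z * w) \<le> \<bar>1 - (cmod z)\<^sup>2\<bar> + cmod z * cmod (z - w)"
    by (metis complex_mod_cnj norm_mult norm_of_real norm_triangle_ineq)
  moreover have "\<bar>1 - (cmod z)\<^sup>2\<bar> \<le> 2 * (1 - cmod z)"
  proof -
    have "1 - (cmod z)\<^sup>2 = (1 + cmod z) * (1 - cmod z)" by (simp add: algebra_simps power2_eq_square)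
    moreover have "\<dots> \<le> 2 * (1 - cmod z)" using assms by (intro mult_right_mono) auto
    moreover have "0 \<le> (1 + cmod z) * (1 - cmod z)" using assms by (intro mult_nonneg_nonneg) auto
    ultimately show ?thesis by simp
  qed
  moreover have "cmod z * cmod (z - w) \<le> 1 * cmod (z - w)"
    using assms by (intro mult_right_mono) auto
  ultimately show ?thesis by linarith
qed

lemma mem_pseudo_disk_iff:
  assumes "z \<in> disk"
  shows "w \<in> pseudo_disk z r \<longleftrightarrow> w \<in> disk \<and> cmod (z - w) < r * cmod (1 - cnj z * w)"
proof (cases "w \<in> disk")
  case True
  then have "cmod (1 - cnj z * w) > 0"
    using one_minus_norm_le(1)[OF assms True] assms by (auto simp del: zero_less_norm_iff)
  then show ?thesis using True by (simp add: pseudo_disk_def norm_divide divide_less_eq)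
qed (simp add: pseudo_disk_def)

lemma pseudo_disk_commute:
  assumes "z \<in> disk" "w \<in> disk"
  shows "w \<in> pseudo_disk z r \<longleftrightarrow> z \<in> pseudo_disk w r"
proof -
  have "cmod (1 - cnj z * w) = cmod (1 - cnj w * z)"
    by (metis complex_cnj_cnj complex_cnj_diff complex_cnj_mult complex_cnj_one complex_mod_cnj mult.commute)
  then show ?thesis using assms by (simp add: mem_pseudo_disk_iff norm_minus_commute)
qed

lemma pseudo_disk_subset_disk: "pseudo_disk z r \<subseteq> disk"
  by (auto simp: pseudo_disk_def)

text \<open>Membership bounds \<open>|z - w|\<close> by \<open>r |1 - cnj z * w|\<close>; inserted in \<open>norm_one_minus_cnj_le\<close>, this lets
the last term be absorbed on the left.\<close>

lemma pseudo_disk_kernel_bound: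
  assumes "z \<in> disk" "r < 1" "w \<in> pseudo_disk z r"
  shows "cmod (1 - cnj z * w) \<le> 2 / (1 - r) * (1 - cmod z)"
proof -
  have "cmod (z - w) < r * cmod (1 - cnj z * w)" using assms mem_pseudo_disk_iff by auto
  then have "(1 - r) * cmod (1 - cnj z * w) \<le> 2 * (1 - cmod z)"
    using norm_one_minus_cnj_le[OF assms(1), of w] by (simp add: algebra_simps)
  then show ?thesis using assms(2) by (simp add: field_simps)
qed

lemma pseudo_disk_dist_bound:
  assumes "z \<in> disk" "r \<in> {0<..<1}" "w \<in> pseudo_disk z r"
  shows "cmod (z - w) < 2 / (1 - r) * (1 - cmod z)"
proof -
  have w: "w \<in> disk" using assms(3) pseudo_disk_subset_disk by blast
  have "cmod (z - w) < r * cmod (1 - cnj z * w)" using assms mem_pseudo_disk_iff by auto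
  also have "\<dots> \<le> 1 * cmod (1 - cnj z * w)" using assms(2) by (intro mult_right_mono) auto
  finally show ?thesis using pseudo_disk_kernel_bound[OF assms(1) _ assms(3)] assms(2) by simp
qed

lemma pseudo_disk_boundary_distance:
  assumes "z \<in> disk" "r \<in> {0<..<1}" "w \<in> pseudo_disk z r"
  shows "1 - cmod z \<le> 2 / (1 - r) * (1 - cmod w)"
proof -
  have w: "w \<in> disk" using assms(3) pseudo_disk_subset_disk by blast
  then have "z \<in> pseudo_disk w r" using pseudo_disk_commute assms by blast
  from pseudo_disk_kernel_bound[OF w _ this] one_minus_norm_le(2)[OF w assms(1)] assms(2)
  show ?thesis by simp
qed

lemma ball_subset_pseudo_disk:
  assumes "z \<in> disk" "r \<in> {0<..<1}"
  shows "ball z (r * (1 - cmod z)) \<subseteq> pseudo_disk z r"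
proof
  fix w assume "w \<in> ball z (r * (1 - cmod z))"
  then have w: "cmod (z - w) < r * (1 - cmod z)" by (simp add: dist_norm)
  moreover have "r * (1 - cmod z) \<le> 1 * (1 - cmod z)" using assms by (intro mult_right_mono) auto
  ultimately have wd: "w \<in> disk" using norm_triangle_ineq2[of w z] by (simp add: norm_minus_commute)
  have "r * (1 - cmod z) \<le> r * cmod (1 - cnj z * w)"
    using one_minus_norm_le(1)[OF assms(1) wd] assms(2) by (intro mult_left_mono) auto
  with w wd show "w \<in> pseudo_disk z r" using mem_pseudo_disk_iff[OF assms(1)] by simp
qed

text \<open>The room between the radii \<open>r\<close> and \<open>(1 + r) / 2\<close> is what allows the sub-mean-value inequality to be
applied at every point of a lattice disk while staying in the enlarged disk.\<close>

lemma ball_subset_larger_pseudo_disk: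
  assumes z: "z \<in> disk" and r: "r \<in> {0<..<1}" and w: "w \<in> pseudo_disk z r"
  shows "ball w ((1 - r) / 4 * (1 - cmod z)) \<subseteq> pseudo_disk z ((1 + r) / 2)"
proof
  fix u assume "u \<in> ball w ((1 - r) / 4 * (1 - cmod z))"
  then have u: "cmod (w - u) < (1 - r) / 4 * (1 - cmod z)" by (simp add: dist_norm)
  have wd: "w \<in> disk" using w pseudo_disk_subset_disk by blast
  have "(1 - r) / 4 * (1 - cmod z) \<le> (1 - r) / 4 * (2 / (1 - r) * (1 - cmod w))"
    using pseudo_disk_boundary_distance[OF z r w] r by (intro mult_left_mono) auto
  also have "\<dots> = (1 - cmod w) / 2" using r by (simp add: field_simps)
  finally have "cmod (w - u) < 1 - cmod w" using u wd by simp
  then have ud: "u \<in> disk" using norm_triangle_ineq2[of u w] by (simp add: norm_minus_commute)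
  have "cmod (1 - cnj z * w) \<le> cmod (1 - cnj z * u) + cmod (w - u)"
  proof -
    have "1 - cnj z * w = (1 - cnj z * u) - cnj z * (w - u)" by (simp add: algebra_simps)
    then have "cmod (1 - cnj z * w) \<le> cmod (1 - cnj z * u) + cmod (cnj z * (w - u))"
      by (metis norm_triangle_ineq4)
    moreover have "cmod (cnj z * (w - u)) \<le> 1 * cmod (w - u)"
      unfolding norm_mult using z by (intro mult_right_mono) auto
    ultimately show ?thesis by simp
  qed
  then have "r * cmod (1 - cnj z * w) \<le> r * (cmod (1 - cnj z * u) + cmod (w - u))"
    using r by (intro mult_left_mono) auto
  also have "\<dots> \<le> r * cmod (1 - cnj z * u) + cmod (w - u)"
    using r mult_right_mono[of r 1 "cmod (w - u)"] by (simp add: distrib_left)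
  finally have "cmod (z - w) < r * cmod (1 - cnj z * u) + cmod (w - u)"
    using w mem_pseudo_disk_iff[OF z, of w r] by simp
  then have "cmod (z - u) < r * cmod (1 - cnj z * u) + 2 * cmod (w - u)"
    using norm_triangle_ineq[of "z - w" "w - u"] by simp
  also have "2 * cmod (w - u) \<le> (1 - r) / 2 * (1 - cmod z)" using u by simp
  also have "\<dots> \<le> (1 - r) / 2 * cmod (1 - cnj z * u)"
    using one_minus_norm_le(1)[OF z ud] r by (intro mult_left_mono) auto
  finally have "cmod (z - u) < (1 + r) / 2 * cmod (1 - cnj z * u)" by (simp add: field_simps)
  then show "u \<in> pseudo_disk z ((1 + r) / 2)" using ud mem_pseudo_disk_iff[OF z] by simp
qed

lemma open_pseudo_disk:
  assumes "z \<in> disk" shows "open (pseudo_disk z r)"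
proof -
  have "pseudo_disk z r = disk \<inter> {w. cmod (z - w) < r * cmod (1 - cnj z * w)}"
    using mem_pseudo_disk_iff[OF assms] by auto
  also have "open \<dots>" by (intro open_Int open_ball open_Collect_less continuous_intros)
  finally show ?thesis .
qed

section \<open>Area measure on the disk\<close>

lemma sets_disk_area [measurable_cong]: "sets disk_area = sets (restrict_space borel disk)"
  by (simp add: disk_area_def) (metis sets_lborel sets_restrict_space_cong)

lemma space_disk_area [simp]: "space disk_area = disk"
  by (simp add: disk_area_def space_restrict_space)

lemma sets_disk_area_iff: "A \<in> sets disk_area \<longleftrightarrow> A \<in> sets borel \<and> A \<subseteq> disk"
  unfolding sets_disk_area by (subst sets_restrict_space_iff) auto

lemma nn_integral_disk_area:
  assumes "g \<in> borel_measurable disk_area"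
  shows "(\<integral>\<^sup>+z. g z \<partial>disk_area) = ennreal (1 / pi) * (\<integral>\<^sup>+z. g z * indicator disk z \<partial>lborel)"
proof -
  have [measurable]: "g \<in> borel_measurable (restrict_space lborel disk)"
    using assms by (simp add: disk_area_def)
  have "(\<integral>\<^sup>+z. g z \<partial>disk_area) = (\<integral>\<^sup>+z. ennreal (1 / pi) * g z \<partial>restrict_space lborel disk)"
    unfolding disk_area_def by (subst nn_integral_density) auto
  also have "\<dots> = ennreal (1 / pi) * (\<integral>\<^sup>+z. g z \<partial>restrict_space lborel disk)"
    by (rule nn_integral_cmult) measurable
  also have "(\<integral>\<^sup>+z. g z \<partial>restrict_space lborel disk) = (\<integral>\<^sup>+z. g z * indicator disk z \<partial>lborel)"
    by (rule nn_integral_restrict_space) simp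
  finally show ?thesis .
qed

lemma emeasure_disk_area:
  assumes "A \<in> sets borel" "A \<subseteq> disk"
  shows "emeasure disk_area A = ennreal (1 / pi) * emeasure lborel A"
proof -
  have A: "A \<in> sets disk_area" using assms by (simp add: sets_disk_area_iff)
  have "emeasure disk_area A = (\<integral>\<^sup>+z. indicator A z \<partial>disk_area)" using A by simp
  also have "\<dots> = ennreal (1 / pi) * (\<integral>\<^sup>+z. indicator A z * indicator disk z \<partial>lborel)"
    using A by (intro nn_integral_disk_area) simp
  also have "(\<lambda>z. indicator A z * indicator disk z :: ennreal) = indicator A"
    using assms(2) by (auto simp: indicator_def fun_eq_iff)
  finally show ?thesis using assms by simp
qed

lemma emeasure_complex_ball:
  assumes "\<rho> \<ge> 0" shows "emeasure lborel (ball (a::complex) \<rho>) = ennreal (pi * \<rho>\<^sup>2)"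
  using assms by (simp add: emeasure_ball unit_ball_vol_2)

lemma emeasure_disk_area_ball_le:
  assumes "\<rho> \<ge> 0" shows "emeasure disk_area (ball a \<rho> \<inter> disk) \<le> ennreal (\<rho>\<^sup>2)"
proof -
  have "emeasure disk_area (ball a \<rho> \<inter> disk) \<le> ennreal (1 / pi) * emeasure lborel (ball a \<rho>)"
    by (subst emeasure_disk_area) (auto intro!: mult_left_mono emeasure_mono)
  also have "\<dots> = ennreal (\<rho>\<^sup>2)"
    using assms by (simp add: emeasure_complex_ball ennreal_mult'[symmetric])
  finally show ?thesis .
qed

lemma emeasure_disk_area_ball:
  assumes "\<rho> \<ge> 0" "ball a \<rho> \<subseteq> disk" shows "emeasure disk_area (ball a \<rho>) = ennreal (\<rho>\<^sup>2)"
  using assms by (simp add: emeasure_disk_area emeasure_complex_ball ennreal_mult'[symmetric])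

lemma pseudo_disk_area_bounds:
  assumes "z \<in> disk" "r \<in> {0<..<1}"
  obtains x where "emeasure disk_area (pseudo_disk z r) = ennreal x"
    "(r * (1 - cmod z))\<^sup>2 \<le> x" "x \<le> (2 / (1 - r) * (1 - cmod z))\<^sup>2" "x > 0"
proof -
  have sets: "pseudo_disk z r \<in> sets disk_area"
    using open_pseudo_disk[OF assms(1)] by (simp add: sets_disk_area_iff pseudo_disk_subset_disk)
  let ?\<rho> = "2 / (1 - r) * (1 - cmod z)"
  have \<rho>: "?\<rho> > 0" using assms by simp
  have "pseudo_disk z r \<subseteq> ball z ?\<rho> \<inter> disk"
    using pseudo_disk_dist_bound[OF assms] pseudo_disk_subset_disk by (auto simp: dist_norm)
  then have up: "emeasure disk_area (pseudo_disk z r) \<le> ennreal (?\<rho>\<^sup>2)"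
    using \<rho> by (intro order_trans[OF emeasure_mono emeasure_disk_area_ball_le]) (auto simp: sets_disk_area_iff)
  have "ennreal ((r * (1 - cmod z))\<^sup>2) = emeasure disk_area (ball z (r * (1 - cmod z)))"
    using ball_subset_pseudo_disk[OF assms] pseudo_disk_subset_disk assms
    by (subst emeasure_disk_area_ball) auto
  also have "\<dots> \<le> emeasure disk_area (pseudo_disk z r)"
    using ball_subset_pseudo_disk[OF assms] sets by (rule emeasure_mono)
  finally have lo: "ennreal ((r * (1 - cmod z))\<^sup>2) \<le> emeasure disk_area (pseudo_disk z r)" .
  obtain x where x: "x \<ge> 0" "emeasure disk_area (pseudo_disk z r) = ennreal x"
    using up by (cases "emeasure disk_area (pseudo_disk z r)") (auto simp: top_unique)
  have "(r * (1 - cmod z))\<^sup>2 \<le> x" "x \<le> ?\<rho>\<^sup>2"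
    using lo up x by auto
  moreover have "(r * (1 - cmod z))\<^sup>2 > 0" using assms by simp
  ultimately show ?thesis using x that by (meson less_le_trans)
qed

lemma disk_power_bound:
  fixes p :: real
  assumes "p > 0"
  obtains K :: real where "K > 0"
    "\<And>f a \<rho>. f holomorphic_on disk \<Longrightarrow> \<rho> > 0 \<Longrightarrow> ball a \<rho> \<subseteq> disk \<Longrightarrow>
       ennreal (\<rho>\<^sup>2 * cmod (f a) powr p) \<le>
         ennreal K * (\<integral>\<^sup>+u. ennreal (cmod (f u) powr p) * indicator (ball a \<rho>) u \<partial>disk_area)"
proof -
  obtain K :: real where K: "K > 0" and bd: 
    "\<And>f a \<rho>. f holomorphic_on ball a \<rho> \<Longrightarrow> \<rho> > 0 \<Longrightarrow>
       ennreal (\<rho>\<^sup>2 * cmod (f a) powr p) \<le>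
         ennreal K * (\<integral>\<^sup>+u. ennreal (cmod (f u) powr p) * indicator (ball a \<rho>) u \<partial>lborel)"
    using area_power_bound[OF assms] by blast
  have "ennreal (\<rho>\<^sup>2 * cmod (f a) powr p) \<le>
         ennreal (K * pi) * (\<integral>\<^sup>+u. ennreal (cmod (f u) powr p) * indicator (ball a \<rho>) u \<partial>disk_area)"
    if hol: "f holomorphic_on disk" and \<rho>: "\<rho> > 0" and sub: "ball a \<rho> \<subseteq> disk" for f a \<rho>
  proof -
    have "f holomorphic_on ball a \<rho>" using hol sub by (rule holomorphic_on_subset)
    note bd[OF this \<rho>]
    also have "(\<integral>\<^sup>+u. ennreal (cmod (f u) powr p) * indicator (ball a \<rho>) u \<partial>lborel) =
      ennreal pi * (\<integral>\<^sup>+u. ennreal (cmod (f u) powr p) * indicator (ball a \<rho>) u \<partial>disk_area)"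
    proof -
      have "f \<in> borel_measurable (restrict_space borel disk)"
        by (intro borel_measurable_continuous_on_restrict holomorphic_on_imp_continuous_on hol)
      then have [measurable]: "f \<in> borel_measurable disk_area"
        using measurable_cong_sets[OF sets_disk_area refl] by blast
      have [measurable]: "ball a \<rho> \<in> sets disk_area" using sub by (simp add: sets_disk_area_iff)
      have "(\<integral>\<^sup>+u. ennreal (cmod (f u) powr p) * indicator (ball a \<rho>) u \<partial>disk_area) =
         ennreal (1 / pi) * (\<integral>\<^sup>+u. ennreal (cmod (f u) powr p) * indicator (ball a \<rho>) u * indicator disk u \<partial>lborel)"
        by (rule nn_integral_disk_area) measurable
      also have "(\<lambda>u. ennreal (cmod (f u) powr p) * indicator (ball a \<rho>) u * indicator disk u) =
         (\<lambda>u. ennreal (cmod (f u) powr p) * indicator (ball a \<rho>) u)"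
        using sub by (auto simp: indicator_def fun_eq_iff)
      finally show ?thesis by (simp add: mult.assoc[symmetric] ennreal_mult'[symmetric])
    qed
    finally show ?thesis using K by (simp add: ennreal_mult' mult.assoc)
  qed
  then show ?thesis using that[of "K * pi"] K by simp
qed

section \<open>Integrals of kernel powers\<close>

text \<open>With \<open>h = 1 - |z|\<close>, the modulus \<open>|1 - cnj z * w|\<close> is at least \<open>h\<close> and at least \<open>|z - w|\<close>. So the
points where it lies between \<open>2\<^sup>n h\<close> and \<open>2\<^sup>n\<^sup>+\<^sup>1 h\<close> are contained in a Euclidean disk about \<open>z\<close> of
normalized area at most \<open>4\<^sup>n\<^sup>+\<^sup>1 h\<^sup>2\<close>. Summing \<open>(2\<^sup>n h)\<^sup>-\<^sup>s 4\<^sup>n\<^sup>+\<^sup>1 h\<^sup>2\<close> gives a geometric series of ratio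
\<open>2\<^sup>2\<^sup>-\<^sup>s\<close>, convergent because \<open>s > 2\<close>.\<close>

lemma disk_kernel_integral_bound:
  fixes s :: real
  assumes s: "s > 2"
  obtains K :: real where "K > 0"
    "\<And>z. z \<in> disk \<Longrightarrow> (\<integral>\<^sup>+w. ennreal (cmod (1 - cnj z * w) powr (- s)) \<partial>disk_area)
        \<le> ennreal (K * (1 - cmod z) powr (2 - s))"
proof -
  define q :: real where "q = 2 powr (2 - s)"
  have q: "0 < q" "q < 1" using s by (auto simp: q_def powr_less_one)
  define K where "K = 4 / (1 - q)"
  have "(\<integral>\<^sup>+w. ennreal (cmod (1 - cnj z * w) powr (- s)) \<partial>disk_area)
        \<le> ennreal (K * (1 - cmod z) powr (2 - s))" if z: "z \<in> disk" for z
  proof -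
    define h where "h = 1 - cmod z"
    have h: "h > 0" using z by (simp add: h_def)
    define B where "B n = ball z (2 ^ Suc n * h) \<inter> disk" for n :: nat
    have B [measurable]: "B n \<in> sets disk_area" for n by (simp add: B_def sets_disk_area_iff)
    define a where "a n = (2 ^ n * h) powr (- s)" for n :: nat
    have term_le: "g n \<le> suminf g" for g :: "nat \<Rightarrow> ennreal" and n
      using sum_le_suminf[OF summableI, of "{n}" g] by simp
    have pt: "ennreal (cmod (1 - cnj z * w) powr (- s)) \<le> (\<Sum>n. ennreal (a n) * indicator (B n) w)"
      if w: "w \<in> disk" for w
    proof -
      define x where "x = cmod (1 - cnj z * w)"
      have x: "h \<le> x" "cmod (z - w) \<le> x"
        using one_minus_norm_le[OF z w] dist_le_norm_one_minus_cnj[OF z w] by (auto simp: x_def h_def)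
      obtain N0 :: nat where "x / h < 2 ^ N0" using real_arch_pow[of 2 "x / h"] by auto
      then have ex: "x < 2 ^ N0 * h" using h by (simp add: field_simps)
      \<comment> \<open>The dyadic shell that contains \<open>w\<close>.\<close>
      define N where "N = (LEAST N. x < 2 ^ N * h)"
      have N: "x < 2 ^ N * h" unfolding N_def by (rule LeastI[of _ N0]) (rule ex)
      then have "N \<noteq> 0" using x(1) by (intro notI) simp
      then obtain n where n: "N = Suc n" by (cases N) auto
      have lo: "2 ^ n * h \<le> x" using not_less_Least[of n "\<lambda>N. x < 2 ^ N * h"] n N_def by auto
      have "w \<in> B n" using x(2) N w by (simp add: B_def n dist_norm)
      moreover have "x powr (- s) \<le> a n" unfolding a_def using lo h s by (intro powr_mono2') auto
      ultimately have "ennreal (x powr (- s)) \<le> ennreal (a n) * indicator (B n) w" by (simp add: ennreal_leI)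
      also have "\<dots> \<le> (\<Sum>n. ennreal (a n) * indicator (B n) w)"
        by (rule term_le)
      finally show ?thesis by (simp add: x_def)
    qed
    have "(\<integral>\<^sup>+w. ennreal (cmod (1 - cnj z * w) powr (- s)) \<partial>disk_area)
        \<le> (\<integral>\<^sup>+w. (\<Sum>n. ennreal (a n) * indicator (B n) w) \<partial>disk_area)"
      by (intro nn_integral_mono pt) simp
    also have "\<dots> = (\<Sum>n. ennreal (a n) * emeasure disk_area (B n))"
      by (simp add: nn_integral_suminf nn_integral_cmult_indicator)
    also have "\<dots> \<le> (\<Sum>n. ennreal (4 * h powr (2 - s) * q ^ n))"
    proof (intro suminf_le summableI)
      fix n
      have "ennreal (a n) * emeasure disk_area (B n) \<le> ennreal (a n) * ennreal ((2 ^ Suc n * h)\<^sup>2)"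
        unfolding B_def using h by (intro mult_left_mono emeasure_disk_area_ball_le) auto
      also have "\<dots> = ennreal (a n * (2 ^ Suc n * h)\<^sup>2)" by (simp add: ennreal_mult'' a_def)
      also have "a n * (2 ^ Suc n * h)\<^sup>2 = 4 * (a n * (2 ^ n * h) powr 2)"
        using h by (simp add: power_mult_distrib)
      also have "a n * (2 ^ n * h) powr 2 = (2 ^ n * h) powr (2 - s)"
        by (simp add: a_def powr_add[symmetric])
      also have "\<dots> = h powr (2 - s) * q ^ n"
        using h by (simp add: powr_mult q_def powr_powr powr_realpow[symmetric] mult.commute)
      finally show "ennreal (a n) * emeasure disk_area (B n) \<le> ennreal (4 * h powr (2 - s) * q ^ n)"
        by (simp add: mult.assoc)
    qed
    also have "\<dots> = ennreal (K * (1 - cmod z) powr (2 - s))"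
    proof (rule suminf_ennreal_eq)
      have "(\<lambda>n. 4 * h powr (2 - s) * q ^ n) sums (4 * h powr (2 - s) * (1 / (1 - q)))"
        by (intro sums_mult geometric_sums) (use q in auto)
      then show "(\<lambda>n. 4 * h powr (2 - s) * q ^ n) sums (K * (1 - cmod z) powr (2 - s))"
        by (simp add: K_def h_def mult.commute)
    qed (use q in auto)
    finally show ?thesis .
  qed
  moreover have "K > 0" using q by (simp add: K_def)
  ultimately show ?thesis using that by blast
qed

lemma norm_normalized_kernel_powr:
  assumes "z \<in> disk" "w \<in> disk"
  shows "cmod (normalized_kernel \<alpha> z w) powr t =
    (1 - (cmod z)\<^sup>2) powr ((\<alpha> + 2) * t / 2) * cmod (1 - cnj z * w) powr (- ((\<alpha> + 2) * t))"
proof -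
  define H where "H = 1 - (cmod z)\<^sup>2"
  have H: "H > 0" using assms(1) by (simp add: H_def abs_square_less_1)
  define x where "x = cmod (1 - cnj z * w)"
  have x: "x > 0" using one_minus_norm_le(1)[OF assms] assms(1) by (simp add: x_def del: zero_less_norm_iff)
  have [simp]: "cmod (1 - cnj w * z) = x"
    unfolding x_def
    by (metis complex_cnj_cnj complex_cnj_diff complex_cnj_mult complex_cnj_one complex_mod_cnj mult.commute)
  have "1 - cnj z * z = of_real H"
    using complex_norm_square[of z] by (simp add: H_def mult.commute)
  then have [simp]: "cmod (1 - cnj z * z) = H" using H by simp
  have "cmod (normalized_kernel \<alpha> z w) = x powr (- (\<alpha> + 2)) / sqrt (H powr (- (\<alpha> + 2)))"
    unfolding normalized_kernel_def bergman_kernel_def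
    by (simp add: norm_divide norm_powr_real_powr')
  also have "sqrt (H powr (- (\<alpha> + 2))) = H powr (- (\<alpha> + 2) / 2)"
    using H by (simp add: powr_half_sqrt[symmetric] powr_powr)
  also have "x powr (- (\<alpha> + 2)) / H powr (- (\<alpha> + 2) / 2) = H powr ((\<alpha> + 2) / 2) * x powr (- (\<alpha> + 2))"
  proof -
    have "- (\<alpha> + 2) / 2 = - ((\<alpha> + 2) / 2)" by (rule minus_divide_left[symmetric])
    then show ?thesis by (simp only: powr_minus divide_inverse inverse_inverse_eq mult.commute)
  qed
  finally show ?thesis
    using H x by (simp add: powr_mult powr_powr H_def x_def algebra_simps)
qed

section \<open>From averages over pseudohyperbolic disks to a Carleson inequality\<close>

lemma measurable_on_disk:
  assumes "sets \<mu> = sets disk_area" "continuous_on disk f"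
  shows "f \<in> borel_measurable \<mu>"
proof -
  have "f \<in> borel_measurable (restrict_space borel disk)"
    using assms(2) by (rule borel_measurable_continuous_on_restrict)
  moreover have "sets \<mu> = sets (restrict_space borel disk)"
    using assms(1) sets_disk_area by simp
  ultimately show ?thesis using measurable_cong_sets by blast
qed

lemma space_eq_disk: "sets \<mu> = sets disk_area \<Longrightarrow> space \<mu> = disk"
  by (metis sets_eq_imp_space_eq space_disk_area)

lemma pseudo_disk_in_sets:
  assumes "sets \<mu> = sets disk_area" "z \<in> disk" shows "pseudo_disk z r \<in> sets \<mu>"
  using assms open_pseudo_disk[OF assms(2)] pseudo_disk_subset_disk by (simp add: sets_disk_area_iff)

lemma measurable_pseudo_disk_pair:
  assumes M: "sets M = sets disk_area" and N: "sets N = sets disk_area"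
  shows "(\<lambda>(u, w). indicator (pseudo_disk u r) w :: ennreal) \<in> borel_measurable (M \<Otimes>\<^sub>M N)"
proof -
  have [measurable]: "(\<lambda>x. x) \<in> borel_measurable M" "(\<lambda>x. x) \<in> borel_measurable N"
    by (auto intro!: measurable_on_disk M N)
  have [measurable]: "cnj \<in> borel_measurable borel"
    by (intro borel_measurable_continuous_onI continuous_intros)
  have "{x \<in> space (M \<Otimes>\<^sub>M N). cmod (fst x - snd x) < r * cmod (1 - cnj (fst x) * snd x)} \<in> sets (M \<Otimes>\<^sub>M N)"
    (is "?S \<in> _")
    by measurable
  then have "(indicator ?S :: _ \<Rightarrow> ennreal) \<in> borel_measurable (M \<Otimes>\<^sub>M N)" by simp
  moreover have "(indicator ?S x :: ennreal) = (\<lambda>(u, w). indicator (pseudo_disk u r) w) x"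
    if "x \<in> space (M \<Otimes>\<^sub>M N)" for x
    using that space_eq_disk[OF M] space_eq_disk[OF N]
    by (cases x) (simp add: space_pair_measure indicator_def mem_pseudo_disk_iff del: mem_ball mem_ball_0)
  ultimately show ?thesis using measurable_cong[of "M \<Otimes>\<^sub>M N" "indicator ?S"] by blast
qed

lemma measurable_emeasure_pseudo_disk:
  assumes "finite_measure \<mu>" and \<mu>: "sets \<mu> = sets disk_area"
  shows "(\<lambda>z. emeasure \<mu> (pseudo_disk z r)) \<in> borel_measurable disk_area"
proof -
  interpret finite_measure \<mu> by fact
  have "(\<lambda>z. \<integral>\<^sup>+w. indicator (pseudo_disk z r) w \<partial>\<mu>) \<in> borel_measurable disk_area"
    by (rule borel_measurable_nn_integral) (rule measurable_pseudo_disk_pair[OF refl \<mu>])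
  then show ?thesis
    by (rule measurable_cong[THEN iffD1, rotated]) (simp add: pseudo_disk_in_sets[OF \<mu>] del: mem_ball mem_ball_0)
qed

lemma finite_measure_disk_area: "finite_measure disk_area"
proof
  have "emeasure disk_area (ball 0 1) = ennreal (1\<^sup>2)" by (rule emeasure_disk_area_ball) auto
  then show "emeasure disk_area (space disk_area) \<noteq> \<infinity>" by simp
qed

lemma measurable_averaging:
  assumes "finite_measure \<mu>" "sets \<mu> = sets disk_area"
  shows "averaging r \<mu> \<in> borel_measurable disk_area"
  unfolding averaging_def[abs_def]
  by (intro borel_measurable_divide_ennreal measurable_emeasure_pseudo_disk assms finite_measure_disk_area refl)

lemma emeasure_le_averaging:
  assumes "z \<in> disk" "r \<in> {0<..<1}"
  shows "emeasure \<mu> (pseudo_disk z r) \<le> ennreal ((2 / (1 - r) * (1 - cmod z))\<^sup>2) * averaging r \<mu> z"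
proof -
  obtain x where x: "emeasure disk_area (pseudo_disk z r) = ennreal x"
    "x \<le> (2 / (1 - r) * (1 - cmod z))\<^sup>2" "x > 0"
    using pseudo_disk_area_bounds[OF assms] by metis
  have "emeasure \<mu> (pseudo_disk z r) = ennreal x * averaging r \<mu> z"
    using x by (simp add: averaging_def ennreal_times_divide mult.commute[of "ennreal x"] ennreal_mult_divide_eq)
  also have "\<dots> \<le> ennreal ((2 / (1 - r) * (1 - cmod z))\<^sup>2) * averaging r \<mu> z"
    using x(2) by (intro mult_right_mono ennreal_leI) auto
  finally show ?thesis .
qed

lemma averaging_le_emeasure:
  assumes "z \<in> disk" "r \<in> {0<..<1}"
  shows "averaging r \<mu> z \<le> ennreal (1 / (r * (1 - cmod z))\<^sup>2) * emeasure \<mu> (pseudo_disk z r)"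
proof -
  obtain x where x: "emeasure disk_area (pseudo_disk z r) = ennreal x"
    "(r * (1 - cmod z))\<^sup>2 \<le> x" "x > 0"
    using pseudo_disk_area_bounds[OF assms] by metis
  have "averaging r \<mu> z = ennreal (1 / x) * emeasure \<mu> (pseudo_disk z r)"
    using x by (simp add: averaging_def divide_ennreal_def inverse_ennreal mult.commute inverse_eq_divide)
  also have "\<dots> \<le> ennreal (1 / (r * (1 - cmod z))\<^sup>2) * emeasure \<mu> (pseudo_disk z r)"
    using x(2,3) assms by (intro mult_right_mono ennreal_leI divide_left_mono) auto
  finally show ?thesis .
qed

text \<open>Integrate the sub-mean-value inequality at \<open>w\<close> over \<open>pseudo_disk w R\<close> against \<open>\<mu>\<close>. Membership
\<open>u \<in> pseudo_disk w R\<close> is symmetric and forces \<open>1 - |u|\<close> and \<open>1 - |w|\<close> to be comparable, so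
exchanging the integrals leaves \<open>\<mu>(pseudo_disk u R) / (1 - |u|)\<^sup>2\<close>, which is comparable to the
average at \<open>u\<close>.\<close>

lemma power_integral_le_averages:
  fixes p R :: real
  assumes p: "p > 0" and R: "R \<in> {0<..<1}"
  obtains K :: real where "K > 0"
    "\<And>f \<mu>. f holomorphic_on disk \<Longrightarrow> finite_measure \<mu> \<Longrightarrow> sets \<mu> = sets disk_area \<Longrightarrow>
       (\<integral>\<^sup>+w. ennreal (cmod (f w) powr p) \<partial>\<mu>) \<le>
         ennreal K * (\<integral>\<^sup>+u. ennreal (cmod (f u) powr p) * averaging R \<mu> u \<partial>disk_area)"
proof -
  obtain K0 :: real where K0: "K0 > 0" and bd:
    "\<And>f a \<rho>. f holomorphic_on disk \<Longrightarrow> \<rho> > 0 \<Longrightarrow> ball a \<rho> \<subseteq> disk \<Longrightarrow>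
       ennreal (\<rho>\<^sup>2 * cmod (f a) powr p) \<le>
         ennreal K0 * (\<integral>\<^sup>+u. ennreal (cmod (f u) powr p) * indicator (ball a \<rho>) u \<partial>disk_area)"
    using disk_power_bound[OF p] by blast
  define c where "c = 2 / (1 - R)"
  have c: "c > 0" using R by (simp add: c_def)
  define K1 where "K1 = K0 * (c / R)\<^sup>2"
  have K1: "K1 > 0" using K0 c R by (simp add: K1_def)
  define K where "K = K1 * c\<^sup>2"
  have "(\<integral>\<^sup>+w. ennreal (cmod (f w) powr p) \<partial>\<mu>) \<le>
         ennreal K * (\<integral>\<^sup>+u. ennreal (cmod (f u) powr p) * averaging R \<mu> u \<partial>disk_area)"
    if hol: "f holomorphic_on disk" and fin: "finite_measure \<mu>" and \<mu>: "sets \<mu> = sets disk_area" for f \<mu>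
  proof -
    interpret \<mu>: finite_measure \<mu> by fact
    interpret A: finite_measure disk_area by (rule finite_measure_disk_area)
    interpret pair_sigma_finite disk_area \<mu> ..
    have [measurable]: "f \<in> borel_measurable disk_area"
      by (intro measurable_on_disk refl holomorphic_on_imp_continuous_on hol)
    have [measurable]: "(\<lambda>z. z) \<in> borel_measurable disk_area"
      by (intro measurable_on_disk refl continuous_intros)
    define g where "g u = ennreal (cmod (f u) powr p / (1 - cmod u)\<^sup>2)" for u
    have [measurable]: "g \<in> borel_measurable disk_area"
      unfolding g_def by measurable
    note [measurable] = measurable_pseudo_disk_pair[OF refl \<mu>, of R]
    have [measurable]: "(\<lambda>(u, w). g u * indicator (pseudo_disk u R) w) \<in> borel_measurable (disk_area \<Otimes>\<^sub>M \<mu>)"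
    proof -
      have "(\<lambda>x. g (fst x) * (\<lambda>(u, w). indicator (pseudo_disk u R) w) x) \<in> borel_measurable (disk_area \<Otimes>\<^sub>M \<mu>)"
        by measurable
      then show ?thesis by (simp add: case_prod_unfold)
    qed
    have pt: "ennreal (cmod (f w) powr p) \<le>
        ennreal K1 * (\<integral>\<^sup>+u. g u * indicator (pseudo_disk u R) w \<partial>disk_area)" if w: "w \<in> disk" for w
    proof -
      define \<rho> where "\<rho> = R * (1 - cmod w)"
      have \<rho>: "\<rho> > 0" using R w by (simp add: \<rho>_def)
      have sub: "ball w \<rho> \<subseteq> pseudo_disk w R"
        using ball_subset_pseudo_disk[OF w R] by (simp add: \<rho>_def)
      have "ennreal (\<rho>\<^sup>2 * cmod (f w) powr p) \<le>
         ennreal K0 * (\<integral>\<^sup>+u. ennreal (cmod (f u) powr p) * indicator (ball w \<rho>) u \<partial>disk_area)"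
        using bd[OF hol \<rho>, of w] sub pseudo_disk_subset_disk by blast
      also have "(\<integral>\<^sup>+u. ennreal (cmod (f u) powr p) * indicator (ball w \<rho>) u \<partial>disk_area) \<le>
          (\<integral>\<^sup>+u. ennreal ((c * (1 - cmod w))\<^sup>2) * (g u * indicator (pseudo_disk u R) w) \<partial>disk_area)"
      proof (intro nn_integral_mono)
        fix u assume "u \<in> space disk_area"
        then have u: "u \<in> disk" by simp
        show "ennreal (cmod (f u) powr p) * indicator (ball w \<rho>) u \<le>
            ennreal ((c * (1 - cmod w))\<^sup>2) * (g u * indicator (pseudo_disk u R) w)"
        proof (cases "u \<in> ball w \<rho>")
          case True
          then have uE: "u \<in> pseudo_disk w R" using sub by blast
          then have wE: "w \<in> pseudo_disk u R" using pseudo_disk_commute[OF w u] by blast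
          have "1 - cmod u \<le> c * (1 - cmod w)"
            using pseudo_disk_boundary_distance[OF u R wE] by (simp add: c_def)
          then have "(1 - cmod u)\<^sup>2 \<le> (c * (1 - cmod w))\<^sup>2" using u by (intro power_mono) auto
          then have "cmod (f u) powr p * (1 - cmod u)\<^sup>2 \<le> cmod (f u) powr p * (c * (1 - cmod w))\<^sup>2"
            by (rule mult_left_mono) simp
          then have "cmod (f u) powr p \<le> (c * (1 - cmod w))\<^sup>2 * (cmod (f u) powr p / (1 - cmod u)\<^sup>2)"
            using u by (simp add: field_simps)
          then have "ennreal (cmod (f u) powr p) \<le> ennreal ((c * (1 - cmod w))\<^sup>2) * g u"
            unfolding g_def by (subst ennreal_mult'[symmetric]) (simp_all only: ennreal_leI zero_le_power2)
          then show ?thesis using True wE by simp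
        qed simp
      qed
      also have "\<dots> = ennreal ((c * (1 - cmod w))\<^sup>2) * (\<integral>\<^sup>+u. g u * indicator (pseudo_disk u R) w \<partial>disk_area)"
      proof (rule nn_integral_cmult)
        have "w \<in> space \<mu>" using w space_eq_disk[OF \<mu>] by simp
        then have "(\<lambda>u. (u, w)) \<in> disk_area \<rightarrow>\<^sub>M disk_area \<Otimes>\<^sub>M \<mu>" by simp
        from measurable_compose[OF this, of "\<lambda>(u, w). g u * indicator (pseudo_disk u R) w" borel]
        show "(\<lambda>u. g u * indicator (pseudo_disk u R) w) \<in> borel_measurable disk_area" by simp
      qed
      finally have "ennreal (\<rho>\<^sup>2 * cmod (f w) powr p) \<le> ennreal K0 *
          (ennreal ((c * (1 - cmod w))\<^sup>2) * (\<integral>\<^sup>+u. g u * indicator (pseudo_disk u R) w \<partial>disk_area))"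
        by (simp add: mult_left_mono)
      then have "ennreal (1 / \<rho>\<^sup>2) * ennreal (\<rho>\<^sup>2 * cmod (f w) powr p) \<le> ennreal (1 / \<rho>\<^sup>2) * (ennreal K0 *
          (ennreal ((c * (1 - cmod w))\<^sup>2) * (\<integral>\<^sup>+u. g u * indicator (pseudo_disk u R) w \<partial>disk_area)))"
        by (rule mult_left_mono) simp
      also have "\<dots> = ennreal (1 / \<rho>\<^sup>2 * (K0 * (c * (1 - cmod w))\<^sup>2)) *
          (\<integral>\<^sup>+u. g u * indicator (pseudo_disk u R) w \<partial>disk_area)"
      proof -
        have "ennreal (1 / \<rho>\<^sup>2 * (K0 * (c * (1 - cmod w))\<^sup>2)) =
            ennreal (1 / \<rho>\<^sup>2) * (ennreal K0 * ennreal ((c * (1 - cmod w))\<^sup>2))"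
          using K0 by (subst ennreal_mult') (simp, subst ennreal_mult', simp_all)
        then show ?thesis by (simp only: mult.assoc)
      qed
      also have "1 / \<rho>\<^sup>2 * (K0 * (c * (1 - cmod w))\<^sup>2) = K1"
        using w R by (simp add: \<rho>_def K1_def power_mult_distrib power_divide)
      also have "ennreal (1 / \<rho>\<^sup>2) * ennreal (\<rho>\<^sup>2 * cmod (f w) powr p) = ennreal (cmod (f w) powr p)"
        using \<rho> by (subst ennreal_mult'[symmetric]) auto
      finally show ?thesis .
    qed
    have "(\<integral>\<^sup>+w. ennreal (cmod (f w) powr p) \<partial>\<mu>) \<le>
        (\<integral>\<^sup>+w. ennreal K1 * (\<integral>\<^sup>+u. g u * indicator (pseudo_disk u R) w \<partial>disk_area) \<partial>\<mu>)"
      by (intro nn_integral_mono pt) (simp add: space_eq_disk[OF \<mu>])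
    also have "\<dots> = ennreal K1 * (\<integral>\<^sup>+w. (\<integral>\<^sup>+u. g u * indicator (pseudo_disk u R) w \<partial>disk_area) \<partial>\<mu>)"
    proof (rule nn_integral_cmult)
      have "(\<lambda>(w, u). g u * indicator (pseudo_disk u R) w) \<in> borel_measurable (\<mu> \<Otimes>\<^sub>M disk_area)"
        using measurable_pair_swap[of "\<lambda>(u, w). g u * indicator (pseudo_disk u R) w" disk_area \<mu> borel] by simp
      then show "(\<lambda>w. \<integral>\<^sup>+u. g u * indicator (pseudo_disk u R) w \<partial>disk_area) \<in> borel_measurable \<mu>"
        by (rule A.borel_measurable_nn_integral)
    qed
    also have "(\<integral>\<^sup>+w. (\<integral>\<^sup>+u. g u * indicator (pseudo_disk u R) w \<partial>disk_area) \<partial>\<mu>) =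
        (\<integral>\<^sup>+u. (\<integral>\<^sup>+w. g u * indicator (pseudo_disk u R) w \<partial>\<mu>) \<partial>disk_area)"
      by (rule Fubini') measurable
    also have "\<dots> \<le> (\<integral>\<^sup>+u. ennreal (c\<^sup>2) * (ennreal (cmod (f u) powr p) * averaging R \<mu> u) \<partial>disk_area)"
    proof (intro nn_integral_mono)
      fix u assume "u \<in> space disk_area"
      then have u: "u \<in> disk" by simp
      have "(\<integral>\<^sup>+w. g u * indicator (pseudo_disk u R) w \<partial>\<mu>) = g u * emeasure \<mu> (pseudo_disk u R)"
        using pseudo_disk_in_sets[OF \<mu> u] by (rule nn_integral_cmult_indicator)
      also have "\<dots> \<le> g u * (ennreal ((c * (1 - cmod u))\<^sup>2) * averaging R \<mu> u)"
        using emeasure_le_averaging[OF u R] unfolding c_def by (intro mult_left_mono) auto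
      also have "\<dots> = (g u * ennreal ((c * (1 - cmod u))\<^sup>2)) * averaging R \<mu> u" by (simp only: mult.assoc)
      also have "g u * ennreal ((c * (1 - cmod u))\<^sup>2) = ennreal (c\<^sup>2 * cmod (f u) powr p)"
        unfolding g_def using u
        by (subst ennreal_mult''[symmetric]) (simp_all add: power_mult_distrib mult.commute)
      also have "\<dots> = ennreal (c\<^sup>2) * ennreal (cmod (f u) powr p)" by (rule ennreal_mult') simp
      finally show "(\<integral>\<^sup>+w. g u * indicator (pseudo_disk u R) w \<partial>\<mu>) \<le>
          ennreal (c\<^sup>2) * (ennreal (cmod (f u) powr p) * averaging R \<mu> u)" by (simp only: mult.assoc)
    qed
    also have "\<dots> = ennreal (c\<^sup>2) * (\<integral>\<^sup>+u. ennreal (cmod (f u) powr p) * averaging R \<mu> u \<partial>disk_area)"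
    proof -
      note [measurable] = measurable_averaging[OF fin \<mu>]
      show ?thesis by (rule nn_integral_cmult) measurable
    qed
    finally show ?thesis
      using K1 by (simp add: K_def ennreal_mult' mult.assoc mult_left_mono)
  qed
  moreover have "K > 0" using K1 c by (simp add: K_def)
  ultimately show ?thesis using that by blast
qed

text \<open>On each disk \<open>E k\<close> of the lattice the sub-mean-value inequality bounds \<open>|f|\<^sup>p\<close> by its mean over the
enlarged disk \<open>E' k\<close>. The \<open>E k\<close> cover, and a point lies in at most \<open>M\<close> of the \<open>E' k\<close>, so summation
over \<open>k\<close> costs only the factor \<open>M\<close>.\<close>

lemma power_integral_le_lattice_averages:
  fixes p r :: real
  assumes p: "p > 0" and r: "r \<in> {0<..<1}" and lat: "is_lattice r z"
  obtains K :: real where "K > 0"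
    "\<And>f \<mu> L. f holomorphic_on disk \<Longrightarrow> sets \<mu> = sets disk_area \<Longrightarrow>
       (\<And>k. averaging r \<mu> (z k) \<le> L) \<Longrightarrow>
       (\<integral>\<^sup>+w. ennreal (cmod (f w) powr p) \<partial>\<mu>) \<le>
         ennreal K * (L * (\<integral>\<^sup>+u. ennreal (cmod (f u) powr p) \<partial>disk_area))"
proof -
  obtain K0 :: real where K0: "K0 > 0" and bd:
    "\<And>f a \<rho>. f holomorphic_on disk \<Longrightarrow> \<rho> > 0 \<Longrightarrow> ball a \<rho> \<subseteq> disk \<Longrightarrow>
       ennreal (\<rho>\<^sup>2 * cmod (f a) powr p) \<le>
         ennreal K0 * (\<integral>\<^sup>+u. ennreal (cmod (f u) powr p) * indicator (ball a \<rho>) u \<partial>disk_area)"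
    using disk_power_bound[OF p] by blast
  have zd: "z k \<in> disk" for k using lat unfolding is_lattice_def by blast
  define E where "E k = pseudo_disk (z k) r" for k
  define E' where "E' k = pseudo_disk (z k) ((1 + r) / 2)" for k
  have cover: "w \<in> disk \<Longrightarrow> \<exists>k. w \<in> E k" for w using lat by (auto simp: is_lattice_def E_def)
  obtain M :: nat where M: "M > 0" "\<And>w. w \<in> disk \<Longrightarrow> finite {k. w \<in> E' k}"
      "\<And>w. w \<in> disk \<Longrightarrow> card {k. w \<in> E' k} \<le> M"
    using lat unfolding is_lattice_def E'_def by auto
  define c where "c = K0 * (8 / (1 - r)\<^sup>2)\<^sup>2"
  have c: "c > 0" using K0 r by (simp add: c_def)
  have "(\<integral>\<^sup>+w. ennreal (cmod (f w) powr p) \<partial>\<mu>) \<le>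
         ennreal (c * M) * (L * (\<integral>\<^sup>+u. ennreal (cmod (f u) powr p) \<partial>disk_area))"
    if hol: "f holomorphic_on disk" and \<mu>: "sets \<mu> = sets disk_area"
      and L: "\<And>k. averaging r \<mu> (z k) \<le> L" for f \<mu> L
  proof -
    have contf: "continuous_on disk f" using hol by (rule holomorphic_on_imp_continuous_on)
    have [measurable]: "f \<in> borel_measurable disk_area" "f \<in> borel_measurable \<mu>"
      by (auto intro!: measurable_on_disk contf \<mu>)
    have [measurable]: "E k \<in> sets \<mu>" "E' k \<in> sets disk_area" for k
      unfolding E_def E'_def by (intro pseudo_disk_in_sets \<mu> refl zd)+
    define J where "J k = (\<integral>\<^sup>+u. ennreal (cmod (f u) powr p) * indicator (E' k) u \<partial>disk_area)" for k
    have term_le: "g n \<le> suminf g" for g :: "nat \<Rightarrow> ennreal" and n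
      using sum_le_suminf[OF summableI, of "{n}" g] by simp
    have on_disk_k: "(\<integral>\<^sup>+w. ennreal (cmod (f w) powr p) * indicator (E k) w \<partial>\<mu>) \<le> ennreal c * L * J k" for k
    proof -
      define h where "h = 1 - cmod (z k)"
      have h: "h > 0" using zd[of k] by (simp add: h_def)
      define \<rho> where "\<rho> = (1 - r) / 4 * h"
      have \<rho>: "\<rho> > 0" using h r by (simp add: \<rho>_def)
      have pt: "ennreal (cmod (f w) powr p) \<le> ennreal (K0 / \<rho>\<^sup>2) * J k" if w: "w \<in> E k" for w
      proof -
        have sub: "ball w \<rho> \<subseteq> E' k"
          using ball_subset_larger_pseudo_disk[OF zd r, of w k] w by (simp add: E_def E'_def \<rho>_def h_def)
        have "ennreal (\<rho>\<^sup>2 * cmod (f w) powr p) \<le>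
            ennreal K0 * (\<integral>\<^sup>+u. ennreal (cmod (f u) powr p) * indicator (ball w \<rho>) u \<partial>disk_area)"
          using bd[OF hol \<rho>, of w] sub pseudo_disk_subset_disk unfolding E'_def by blast
        also have "\<dots> \<le> ennreal K0 * J k"
          unfolding J_def using sub
          by (intro mult_left_mono nn_integral_mono) (auto simp: indicator_def)
        finally have "ennreal (1 / \<rho>\<^sup>2) * ennreal (\<rho>\<^sup>2 * cmod (f w) powr p) \<le> ennreal (1 / \<rho>\<^sup>2) * (ennreal K0 * J k)"
          by (rule mult_left_mono) simp
        moreover have "ennreal (1 / \<rho>\<^sup>2) * ennreal (\<rho>\<^sup>2 * cmod (f w) powr p) = ennreal (cmod (f w) powr p)"
          using \<rho> by (subst ennreal_mult'[symmetric]) auto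
        moreover have "ennreal (1 / \<rho>\<^sup>2) * (ennreal K0 * J k) = ennreal (K0 / \<rho>\<^sup>2) * J k"
          using K0 by (simp add: mult.assoc[symmetric] ennreal_mult''[symmetric])
        ultimately show ?thesis by simp
      qed
      have "(\<integral>\<^sup>+w. ennreal (cmod (f w) powr p) * indicator (E k) w \<partial>\<mu>) \<le>
          (\<integral>\<^sup>+w. ennreal (K0 / \<rho>\<^sup>2) * J k * indicator (E k) w \<partial>\<mu>)"
        using pt by (intro nn_integral_mono) (auto simp: indicator_def)
      also have "\<dots> = ennreal (K0 / \<rho>\<^sup>2) * J k * emeasure \<mu> (E k)"
        by (rule nn_integral_cmult_indicator) measurable
      also have "\<dots> \<le> ennreal (K0 / \<rho>\<^sup>2) * J k * (ennreal ((2 / (1 - r) * h)\<^sup>2) * L)"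
      proof (rule mult_left_mono)
        have "emeasure \<mu> (E k) \<le> ennreal ((2 / (1 - r) * h)\<^sup>2) * averaging r \<mu> (z k)"
          using emeasure_le_averaging[OF zd r] unfolding E_def h_def .
        also have "\<dots> \<le> ennreal ((2 / (1 - r) * h)\<^sup>2) * L" using L by (intro mult_left_mono) auto
        finally show "emeasure \<mu> (E k) \<le> ennreal ((2 / (1 - r) * h)\<^sup>2) * L" .
      qed simp
      also have "\<dots> = ennreal (K0 / \<rho>\<^sup>2) * ennreal ((2 / (1 - r) * h)\<^sup>2) * (L * J k)"
        by (simp only: mult_ac)
      also have "ennreal (K0 / \<rho>\<^sup>2) * ennreal ((2 / (1 - r) * h)\<^sup>2) = ennreal (K0 / \<rho>\<^sup>2 * (2 / (1 - r) * h)\<^sup>2)"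
        using K0 by (subst ennreal_mult') auto
      also have "K0 / \<rho>\<^sup>2 * (2 / (1 - r) * h)\<^sup>2 = c"
      proof -
        define d where "d = 1 - r"
        have "d > 0" using r by (simp add: d_def)
        then show ?thesis
          unfolding \<rho>_def c_def d_def[symmetric] using h by (simp add: power2_eq_square field_simps)
      qed
      finally show ?thesis by (simp only: mult.assoc)
    qed
    have "(\<integral>\<^sup>+w. ennreal (cmod (f w) powr p) \<partial>\<mu>) \<le>
        (\<integral>\<^sup>+w. (\<Sum>k. ennreal (cmod (f w) powr p) * indicator (E k) w) \<partial>\<mu>)"
    proof (intro nn_integral_mono)
      fix w assume "w \<in> space \<mu>"
      then obtain k where "w \<in> E k" using cover space_eq_disk[OF \<mu>] by auto
      then have "ennreal (cmod (f w) powr p) \<le> ennreal (cmod (f w) powr p) * indicator (E k) w" by simp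
      also have "\<dots> \<le> (\<Sum>k. ennreal (cmod (f w) powr p) * indicator (E k) w)" by (rule term_le)
      finally show "ennreal (cmod (f w) powr p) \<le> (\<Sum>k. ennreal (cmod (f w) powr p) * indicator (E k) w)" .
    qed
    also have "\<dots> = (\<Sum>k. \<integral>\<^sup>+w. ennreal (cmod (f w) powr p) * indicator (E k) w \<partial>\<mu>)"
      by (rule nn_integral_suminf) measurable
    also have "\<dots> \<le> (\<Sum>k. ennreal c * L * J k)" by (intro suminf_le summableI on_disk_k)
    also have "\<dots> = ennreal c * L * (\<Sum>k. J k)" by simp
    also have "(\<Sum>k. J k) = (\<integral>\<^sup>+u. (\<Sum>k. ennreal (cmod (f u) powr p) * indicator (E' k) u) \<partial>disk_area)"
      unfolding J_def by (rule nn_integral_suminf[symmetric]) measurable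
    also have "\<dots> \<le> (\<integral>\<^sup>+u. ennreal M * ennreal (cmod (f u) powr p) \<partial>disk_area)"
    proof (intro nn_integral_mono)
      fix u assume "u \<in> space disk_area"
      then have u: "u \<in> disk" by simp
      have "(\<Sum>k. ennreal (cmod (f u) powr p) * indicator (E' k) u) =
          (\<Sum>k\<in>{k. u \<in> E' k}. ennreal (cmod (f u) powr p) * indicator (E' k) u)"
        using M(2)[OF u] by (rule suminf_finite) auto
      also have "\<dots> = ennreal (card {k. u \<in> E' k}) * ennreal (cmod (f u) powr p)"
        by (simp add: ennreal_of_nat_eq_real_of_nat)
      also have "\<dots> \<le> ennreal M * ennreal (cmod (f u) powr p)"
        using M(3)[OF u] by (intro mult_right_mono ennreal_leI) auto
      finally show "(\<Sum>k. ennreal (cmod (f u) powr p) * indicator (E' k) u) \<le> ennreal M * ennreal (cmod (f u) powr p)" .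
    qed
    also have "\<dots> = ennreal M * (\<integral>\<^sup>+u. ennreal (cmod (f u) powr p) \<partial>disk_area)"
      by (rule nn_integral_cmult) measurable
    finally have "(\<integral>\<^sup>+w. ennreal (cmod (f w) powr p) \<partial>\<mu>) \<le>
        ennreal c * L * (ennreal M * (\<integral>\<^sup>+u. ennreal (cmod (f u) powr p) \<partial>disk_area))"
      by (simp add: mult_left_mono)
    also have "\<dots> = ennreal c * ennreal M * (L * (\<integral>\<^sup>+u. ennreal (cmod (f u) powr p) \<partial>disk_area))"
      by (simp only: mult_ac)
    also have "ennreal c * ennreal M = ennreal (c * M)"
      using c by (subst ennreal_mult') auto
    finally show ?thesis .
  qed
  moreover have "c * M > 0" using c M(1) by simp
  ultimately show ?thesis using that[of "c * M"] by blast
qed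

section \<open>Existence of lattices\<close>

text \<open>A point outside all the disks could be added to a maximal separated set.\<close>

lemma exists_maximal_pseudo_separated:
  assumes r: "r > 0"
  obtains S where "S \<subseteq> disk"
    "\<And>a b. a \<in> S \<Longrightarrow> b \<in> S \<Longrightarrow> a \<noteq> b \<Longrightarrow> r * cmod (1 - cnj a * b) \<le> cmod (a - b)"
    "disk \<subseteq> (\<Union>a\<in>S. pseudo_disk a r)"
proof -
  define sep where "sep S \<longleftrightarrow> S \<subseteq> disk \<and> (\<forall>a\<in>S. \<forall>b\<in>S. a \<noteq> b \<longrightarrow> r * cmod (1 - cnj a * b) \<le> cmod (a - b))" for S
  have "\<exists>S\<in>Collect sep. \<forall>X\<in>Collect sep. S \<subseteq> X \<longrightarrow> X = S"
  proof (rule Zorn_Lemma, intro ballI)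
    fix C assume C: "C \<in> chains (Collect sep)"
    then have Cs: "\<And>X. X \<in> C \<Longrightarrow> sep X" by (auto simp: chains_def)
    have "r * cmod (1 - cnj a * b) \<le> cmod (a - b)" if ab: "a \<in> \<Union> C" "b \<in> \<Union> C" "a \<noteq> b" for a b
    proof -
      obtain X Y where XY: "X \<in> C" "Y \<in> C" "a \<in> X" "b \<in> Y" using ab by auto
      have "X \<subseteq> Y \<or> Y \<subseteq> X" using C XY unfolding chains_def chain_subset_def by blast
      then obtain Z where "Z \<in> C" "a \<in> Z" "b \<in> Z" using XY by blast
      then show ?thesis using Cs[of Z] ab(3) by (simp add: sep_def)
    qed
    moreover have "\<Union> C \<subseteq> disk" using Cs unfolding sep_def by blast
    ultimately show "\<Union> C \<in> Collect sep" by (simp add: sep_def)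
  qed
  then obtain S where S: "sep S" and max: "\<And>X. sep X \<Longrightarrow> S \<subseteq> X \<Longrightarrow> X = S" by auto
  have "w \<in> (\<Union>a\<in>S. pseudo_disk a r)" if w: "w \<in> disk" for w
  proof (rule ccontr)
    assume not: "w \<notin> (\<Union>a\<in>S. pseudo_disk a r)"
    have far: "r * cmod (1 - cnj a * w) \<le> cmod (a - w)" "r * cmod (1 - cnj w * a) \<le> cmod (w - a)" if a: "a \<in> S" for a
    proof -
      have ad: "a \<in> disk" using S a by (auto simp: sep_def)
      show "r * cmod (1 - cnj a * w) \<le> cmod (a - w)"
        using not a mem_pseudo_disk_iff[OF ad, of w r] w by auto
      show "r * cmod (1 - cnj w * a) \<le> cmod (w - a)"
        using not a pseudo_disk_commute[OF ad w, of r] mem_pseudo_disk_iff[OF w, of a r] ad by auto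
    qed
    have "sep (insert w S)"
      using S w far unfolding sep_def by (auto simp del: mem_ball mem_ball_0)
    then have "w \<in> S" using max by blast
    moreover have "w \<in> pseudo_disk w r"
    proof -
      have "cmod (1 - cnj w * w) > 0" using one_minus_norm_le(1)[OF w w] w by (simp del: zero_less_norm_iff)
      then show ?thesis using mem_pseudo_disk_iff[OF w, of w r] w r by simp
    qed
    ultimately show False using not by blast
  qed
  then show ?thesis using that[of S] S unfolding sep_def by blast
qed

text \<open>The points \<open>a\<close> with \<open>w \<in> pseudo_disk a R\<close> all lie within a multiple of \<open>h = 1 - |w|\<close> of \<open>w\<close>, and
separation keeps them a multiple of \<open>h\<close> apart. Small disjoint balls around them fit in one ball
about \<open>w\<close>, and comparing areas bounds their number.\<close>

lemma pseudo_separated_overlap: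
  assumes S: "S \<subseteq> disk" and r: "r > 0" and R: "R \<in> {0<..<1}"
    and sep: "\<And>a b. a \<in> S \<Longrightarrow> b \<in> S \<Longrightarrow> a \<noteq> b \<Longrightarrow> r * cmod (1 - cnj a * b) \<le> cmod (a - b)"
  obtains M :: nat where "M > 0"
    "\<And>w. w \<in> disk \<Longrightarrow> finite {a \<in> S. w \<in> pseudo_disk a R} \<and> card {a \<in> S. w \<in> pseudo_disk a R} \<le> M"
proof -
  define c where "c = r * (1 - R) / 4"
  have c: "c > 0" using r R by (simp add: c_def)
  define C where "C = 2 / (1 - R) + c"
  have C: "C > 0" using c R by (simp add: C_def add_pos_pos)
  define M where "M = nat \<lceil>(C / c)\<^sup>2\<rceil>"
  have key: "card F \<le> M" if w: "w \<in> disk" and F: "finite F" "F \<subseteq> {a \<in> S. w \<in> pseudo_disk a R}" for w F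
  proof -
    define h where "h = 1 - cmod w"
    have h: "h > 0" using w by (simp add: h_def)
    have disj: "disjoint_family_on (\<lambda>a. ball a (c * h)) F"
    proof (unfold disjoint_family_on_def, intro ballI impI)
      fix a b assume ab: "a \<in> F" "b \<in> F" "a \<noteq> b"
      have aS: "a \<in> S" "b \<in> S" "a \<in> disk" "b \<in> disk" "w \<in> pseudo_disk a R" using ab F S by auto
      then have "a \<in> pseudo_disk w R" using pseudo_disk_commute w by blast
      then have "h \<le> 2 / (1 - R) * (1 - cmod a)"
        using pseudo_disk_boundary_distance[OF w R] by (simp add: h_def)
      also have "\<dots> \<le> 2 / (1 - R) * cmod (1 - cnj a * b)"
        using one_minus_norm_le(1)[OF aS(3,4)] R by (intro mult_left_mono) auto
      finally have "2 * c * h \<le> 2 * c * (2 / (1 - R) * cmod (1 - cnj a * b))"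
        using c by (intro mult_left_mono) auto
      also have "\<dots> = r * cmod (1 - cnj a * b)" using R by (simp add: c_def field_simps)
      also have "\<dots> \<le> cmod (a - b)" using sep aS ab(3) by blast
      finally show "ball a (c * h) \<inter> ball b (c * h) = {}"
        by (intro disjoint_ballI) (simp add: dist_norm)
    qed
    have sub: "(\<Union>a\<in>F. ball a (c * h)) \<subseteq> ball w (C * h)"
    proof (rule UN_least)
      fix a assume a: "a \<in> F"
      then have "a \<in> disk" "w \<in> pseudo_disk a R" using F S by auto
      then have "a \<in> pseudo_disk w R" using pseudo_disk_commute w by blast
      then have wa: "cmod (w - a) < 2 / (1 - R) * h" using pseudo_disk_dist_bound[OF w R] by (simp add: h_def)
      show "ball a (c * h) \<subseteq> ball w (C * h)"
      proof
        fix u assume "u \<in> ball a (c * h)"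
        then have "cmod (w - u) < 2 / (1 - R) * h + c * h"
          using wa norm_triangle_ineq[of "w - a" "a - u"] by (simp add: dist_norm)
        then show "u \<in> ball w (C * h)" by (simp add: C_def distrib_right dist_norm)
      qed
    qed
    have "ennreal (card F * (pi * (c * h)\<^sup>2)) = (\<Sum>a\<in>F. emeasure lborel (ball a (c * h)))"
      using c h by (simp add: emeasure_complex_ball ennreal_mult' ennreal_of_nat_eq_real_of_nat)
    also have "\<dots> = emeasure lborel (\<Union>a\<in>F. ball a (c * h))"
      by (intro sum_emeasure disj F) auto
    also have "\<dots> \<le> emeasure lborel (ball w (C * h))" by (intro emeasure_mono sub) simp
    also have "\<dots> = ennreal (pi * (C * h)\<^sup>2)" using C h by (simp add: emeasure_complex_ball)
    finally have "card F * (pi * (c * h)\<^sup>2) \<le> pi * (C * h)\<^sup>2" by simp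
    then have "card F * c\<^sup>2 \<le> C\<^sup>2" using h by (simp add: power_mult_distrib)
    then have "card F \<le> (C / c)\<^sup>2" using c by (simp add: power_divide field_simps)
    then show ?thesis unfolding M_def by linarith
  qed
  have "finite {a \<in> S. w \<in> pseudo_disk a R} \<and> card {a \<in> S. w \<in> pseudo_disk a R} \<le> M" if w: "w \<in> disk" for w
    using finite_if_finite_subsets_card_bdd[of "{a \<in> S. w \<in> pseudo_disk a R}" M] key[OF w] by blast
  moreover have "M > 0"
    using C c unfolding M_def by (metis divide_pos_pos zero_less_ceiling zero_less_nat_eq zero_less_power)
  ultimately show ?thesis using that by blast
qed

text \<open>A lattice is a sequence whose overlap is counted by indices, so the separated set has to be
enumerated injectively by all natural numbers. It is countable since each of its points \<open>a\<close> has a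
point of a countable dense set in its enlarged disk, and each such point serves only finitely many \<open>a\<close>. It
is infinite since finitely many pseudohyperbolic disks stay away from the unit circle.\<close>

lemma exists_lattice:
  assumes r: "r \<in> {0<..<1}"
  shows "\<exists>z. is_lattice r z"
proof -
  have r0: "r > 0" and R: "(1 + r) / 2 \<in> {0<..<1}" using r by auto
  obtain S where S: "S \<subseteq> disk" 
    and sep: "\<And>a b. a \<in> S \<Longrightarrow> b \<in> S \<Longrightarrow> a \<noteq> b \<Longrightarrow> r * cmod (1 - cnj a * b) \<le> cmod (a - b)"
    and cover: "disk \<subseteq> (\<Union>a\<in>S. pseudo_disk a r)"
    using exists_maximal_pseudo_separated[OF r0] by blast
  obtain M :: nat where M: "M > 0"
    "\<And>w. w \<in> disk \<Longrightarrow> finite {a \<in> S. w \<in> pseudo_disk a ((1 + r) / 2)} \<and> card {a \<in> S. w \<in> pseudo_disk a ((1 + r) / 2)} \<le> M"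
    using pseudo_separated_overlap[OF S r0 R sep] by blast
  have inf: "infinite S"
  proof
    assume fin: "finite S"
    have ne: "S \<noteq> {}" using cover by (auto dest: subsetD[of _ _ 0])
    define m where "m = Min ((\<lambda>a. 1 - cmod a) ` S)"
    have m: "m > 0" using fin ne S by (auto simp: m_def)
    have mle: "m \<le> 1 - cmod a" if "a \<in> S" for a using fin that by (simp add: m_def)
    \<comment> \<open>A point so close to the circle that no disk around a point of \<open>S\<close> can reach it.\<close>
    define x where "x = 1 - min 1 ((1 - r) * m / 4)"
    have x: "0 \<le> x" "x < 1" using m r by (auto simp: x_def)
    then have xd: "of_real x \<in> disk" by simp
    then obtain a where a: "a \<in> S" "of_real x \<in> pseudo_disk a r" using cover by blast
    then have "1 - cmod a \<le> 2 / (1 - r) * (1 - x)"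
      using pseudo_disk_boundary_distance[of a r "of_real x"] S r x by auto
    also have "\<dots> \<le> 2 / (1 - r) * ((1 - r) * m / 4)"
      using r by (intro mult_left_mono) (auto simp: x_def)
    also have "\<dots> = m / 2" using r by (simp add: field_simps)
    finally show False using mle[OF a(1)] m by linarith
  qed
  have cnt: "countable S"
  proof -
    obtain D :: "complex set" where D: "countable D" "\<And>U. open U \<Longrightarrow> U \<noteq> {} \<Longrightarrow> \<exists>d\<in>D. d \<in> U"
      using countable_dense_setE by metis
    have "S \<subseteq> (\<Union>d\<in>D \<inter> disk. {a \<in> S. d \<in> pseudo_disk a ((1 + r) / 2)})"
    proof
      fix a assume a: "a \<in> S"
      then have ad: "a \<in> disk" using S by auto
      have "a \<in> ball a ((1 + r) / 2 * (1 - cmod a))" using ad R by simp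
      then have "pseudo_disk a ((1 + r) / 2) \<noteq> {}" using ball_subset_pseudo_disk[OF ad R] by blast
      then obtain d where "d \<in> D" "d \<in> pseudo_disk a ((1 + r) / 2)" using D(2) open_pseudo_disk[OF ad] by blast
      then show "a \<in> (\<Union>d\<in>D \<inter> disk. {a \<in> S. d \<in> pseudo_disk a ((1 + r) / 2)})"
        using a pseudo_disk_subset_disk by blast
    qed
    moreover have "countable (\<Union>d\<in>D \<inter> disk. {a \<in> S. d \<in> pseudo_disk a ((1 + r) / 2)})"
      using D(1) M(2) by (intro countable_UN countable_Int1) (auto intro: countable_finite)
    ultimately show ?thesis by (rule countable_subset)
  qed
  define z where "z = from_nat_into S"
  have bij: "bij_betw z UNIV S" unfolding z_def using cnt inf by (rule bij_betw_from_nat_into)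
  then have ran: "range z = S" and inj: "inj z" by (auto simp: bij_betw_def)
  have "finite {k. w \<in> pseudo_disk (z k) ((1 + r) / 2)} \<and> card {k. w \<in> pseudo_disk (z k) ((1 + r) / 2)} \<le> M"
    if w: "w \<in> disk" for w
  proof -
    have im: "z ` {k. w \<in> pseudo_disk (z k) ((1 + r) / 2)} = {a \<in> S. w \<in> pseudo_disk a ((1 + r) / 2)}"
      using ran by auto
    have inj': "inj_on z {k. w \<in> pseudo_disk (z k) ((1 + r) / 2)}" using inj by (rule inj_on_subset) simp
    show ?thesis using M(2)[OF w] unfolding im[symmetric] by (simp add: card_image[OF inj'] finite_image_iff[OF inj'])
  qed
  then have "is_lattice r z"
    unfolding is_lattice_def using ran S cover M(1) by blast
  then show ?thesis by blast
qed

section \<open>Carleson constants for a weight with two-sided bounds\<close>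

lemma admissible_weight_bounds:
  assumes "admissible_weight \<sigma>"
  obtains c C where "0 < c" "continuous_on {0..1} \<sigma>" "\<And>x. x \<in> {0..1} \<Longrightarrow> c \<le> \<sigma> x \<and> \<sigma> x \<le> C"
proof -
  have w: "\<And>x. x \<in> {0..1} \<Longrightarrow> 0 < \<sigma> x" "C2_unit_interval \<sigma>"
    using assms by (auto simp: admissible_weight_def weight_def)
  obtain \<sigma>' where "\<And>x. x \<in> {0..1} \<Longrightarrow> (\<sigma> has_real_derivative \<sigma>' x) (at x within {0..1})"
    using w(2) unfolding C2_unit_interval_def by blast
  then have cont: "continuous_on {0..1} \<sigma>" by (rule DERIV_continuous_on)
  obtain a where a: "a \<in> {0..1}" "\<And>x. x \<in> {0..1} \<Longrightarrow> \<sigma> a \<le> \<sigma> x"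
    using continuous_attains_inf[OF _ _ cont] by auto
  obtain b where b: "b \<in> {0..1}" "\<And>x. x \<in> {0..1} \<Longrightarrow> \<sigma> x \<le> \<sigma> b"
    using continuous_attains_sup[OF _ _ cont] by auto
  show ?thesis using that[of "\<sigma> a" "\<sigma> b"] w(1)[OF a(1)] a(2) b(2) cont by blast
qed

lemma epowr_mono:
  assumes "s > 0" "x \<le> y" shows "epowr x s \<le> epowr y s"
proof (cases "y = \<infinity>")
  case False
  then have "x < \<infinity>" "y < \<infinity>" using assms(2) by (auto simp: top_unique less_top)
  then show ?thesis using assms by (auto simp: epowr_def intro!: ennreal_leI powr_mono2 enn2real_mono)
qed (simp add: epowr_def)

lemma epowr_powr_inverse:
  assumes "p > 0" shows "epowr (epowr x (1 / p)) p = x"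
  using assms by (cases x) (auto simp: epowr_def powr_powr)

lemma epowr_less_infinity_iff: "epowr x s < \<infinity> \<longleftrightarrow> x < \<infinity>"
  by (auto simp: epowr_def less_top)

lemma epowr_le_one_iff:
  assumes "p > 0" shows "epowr x (1 / p) \<le> 1 \<longleftrightarrow> x \<le> 1"
proof
  have one: "epowr 1 s = 1" for s by (simp add: epowr_def)
  show "epowr x (1 / p) \<le> 1" if "x \<le> 1" using epowr_mono[OF _ that, of "1 / p"] assms one by simp
  show "x \<le> 1" if "epowr x (1 / p) \<le> 1"
    using epowr_mono[OF assms that] one epowr_powr_inverse[OF assms] by simp
qed

text \<open>The operator norm is a supremum of \<open>p\<close>-th roots; raising it to the power \<open>p\<close> commutes with the
supremum because both powers are monotone and mutually inverse.\<close>

lemma epowr_SUP: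
  assumes "p > 0" shows "epowr (SUP i\<in>I. epowr (f i) (1 / p)) p = (SUP i\<in>I. f i)"
proof (rule antisym)
  have "(SUP i\<in>I. epowr (f i) (1 / p)) \<le> epowr (SUP i\<in>I. f i) (1 / p)"
    using assms by (intro SUP_least epowr_mono SUP_upper) auto
  from epowr_mono[OF assms this] show "epowr (SUP i\<in>I. epowr (f i) (1 / p)) p \<le> (SUP i\<in>I. f i)"
    by (simp add: epowr_powr_inverse[OF assms])
  show "(SUP i\<in>I. f i) \<le> epowr (SUP i\<in>I. epowr (f i) (1 / p)) p"
  proof (rule SUP_least)
    fix i assume "i \<in> I"
    then have "epowr (epowr (f i) (1 / p)) p \<le> epowr (SUP i\<in>I. epowr (f i) (1 / p)) p"
      by (intro epowr_mono assms SUP_upper)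
    then show "f i \<le> epowr (SUP i\<in>I. epowr (f i) (1 / p)) p" by (simp add: epowr_powr_inverse[OF assms])
  qed
qed

lemma ennreal_mult_divide:
  assumes "0 \<le> a" "0 < b" shows "ennreal a * I / ennreal b = ennreal (a / b) * I"
proof -
  have "ennreal a * I / ennreal b = ennreal a * inverse (ennreal b) * I"
    by (simp only: divide_ennreal_def mult_ac)
  also have "ennreal a * inverse (ennreal b) = ennreal (a / b)"
    using assms by (simp add: inverse_ennreal ennreal_mult''[symmetric] divide_inverse)
  finally show ?thesis .
qed

text \<open>The \<open>p\<close>-th power of the norm of the embedding of the weighted Bergman space into \<open>L\<^sup>p(\<mu>)\<close>.\<close>

definition carleson_const :: "real \<Rightarrow> (real \<Rightarrow> real) \<Rightarrow> complex measure \<Rightarrow> ennreal" where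
  "carleson_const p \<sigma> \<mu> = (SUP f\<in>{f \<in> bergman_space p \<sigma>. Lp_norm p (weight_measure \<sigma>) f \<le> 1}.
     \<integral>\<^sup>+w. ennreal (cmod (f w) powr p) \<partial>\<mu>)"

lemma bergman_unit_ball_iff:
  assumes "p > 0"
  shows "f \<in> bergman_space p \<sigma> \<and> Lp_norm p (weight_measure \<sigma>) f \<le> 1 \<longleftrightarrow>
    f holomorphic_on disk \<and> (\<integral>\<^sup>+w. ennreal (cmod (f w) powr p) \<partial>weight_measure \<sigma>) \<le> 1"
  using epowr_le_one_iff[OF assms] 
  by (auto simp: bergman_space_def Lp_norm_def epowr_less_infinity_iff[unfolded infinity_ennreal_def] order.strict_trans1[OF _ ennreal_one_less_top])

lemma carleson_const_least:
  assumes "p > 0"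
    "\<And>f. f holomorphic_on disk \<Longrightarrow> (\<integral>\<^sup>+w. ennreal (cmod (f w) powr p) \<partial>weight_measure \<sigma>) \<le> 1 \<Longrightarrow>
       (\<integral>\<^sup>+w. ennreal (cmod (f w) powr p) \<partial>\<mu>) \<le> B"
  shows "carleson_const p \<sigma> \<mu> \<le> B"
  unfolding carleson_const_def bergman_unit_ball_iff[OF assms(1)]
  by (rule SUP_least) (use assms(2) in auto)

lemma carleson_const_upper:
  assumes "p > 0" "f holomorphic_on disk" "(\<integral>\<^sup>+w. ennreal (cmod (f w) powr p) \<partial>weight_measure \<sigma>) \<le> 1"
  shows "(\<integral>\<^sup>+w. ennreal (cmod (f w) powr p) \<partial>\<mu>) \<le> carleson_const p \<sigma> \<mu>"
  unfolding carleson_const_def bergman_unit_ball_iff[OF assms(1)]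
  by (rule SUP_upper) (use assms(2,3) in auto)

locale bounded_weight =
  fixes \<sigma> :: "real \<Rightarrow> real" and c C :: real
  assumes c_pos: "0 < c"
    and continuous: "continuous_on {0..1} \<sigma>"
    and bounds: "\<And>x. x \<in> {0..1} \<Longrightarrow> c \<le> \<sigma> x \<and> \<sigma> x \<le> C"
begin

lemma disk_bounds: "z \<in> disk \<Longrightarrow> c \<le> \<sigma> (cmod z)" "z \<in> disk \<Longrightarrow> \<sigma> (cmod z) \<le> C"
    "z \<in> disk \<Longrightarrow> 0 < \<sigma> (cmod z)"
  using bounds[of "cmod z"] c_pos by auto

lemma C_pos: "0 < C"
  using bounds[of 0] c_pos by auto

lemma measurable_weight [measurable]: "(\<lambda>z. \<sigma> (cmod z)) \<in> borel_measurable disk_area"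
  by (rule measurable_on_disk[OF refl], rule continuous_on_compose2[OF continuous])
     (auto intro!: continuous_intros)

lemma sets_weight_measure: "sets (weight_measure \<sigma>) = sets disk_area"
  by (simp add: weight_measure_def)

lemma nn_integral_weight_measure:
  assumes "g \<in> borel_measurable disk_area"
  shows "(\<integral>\<^sup>+z. g z \<partial>weight_measure \<sigma>) = (\<integral>\<^sup>+z. ennreal (\<sigma> (cmod z)) * g z \<partial>disk_area)"
  unfolding weight_measure_def
proof (rule nn_integral_density)
  show "(\<lambda>z. ennreal (\<sigma> (cmod z))) \<in> borel_measurable disk_area" by measurable
qed (rule assms)

lemma weight_integral_le:
  assumes "g \<in> borel_measurable disk_area"
  shows "(\<integral>\<^sup>+z. g z \<partial>weight_measure \<sigma>) \<le> ennreal C * (\<integral>\<^sup>+z. g z \<partial>disk_area)"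
proof -
  have "(\<integral>\<^sup>+z. g z \<partial>weight_measure \<sigma>) \<le> (\<integral>\<^sup>+z. ennreal C * g z \<partial>disk_area)"
    unfolding nn_integral_weight_measure[OF assms]
    using disk_bounds by (intro nn_integral_mono mult_right_mono ennreal_leI) auto
  then show ?thesis using assms by (simp add: nn_integral_cmult)
qed

lemma area_integral_le:
  assumes "g \<in> borel_measurable disk_area"
  shows "ennreal c * (\<integral>\<^sup>+z. g z \<partial>disk_area) \<le> (\<integral>\<^sup>+z. g z \<partial>weight_measure \<sigma>)"
proof -
  have "(\<integral>\<^sup>+z. ennreal c * g z \<partial>disk_area) \<le> (\<integral>\<^sup>+z. g z \<partial>weight_measure \<sigma>)"
    unfolding nn_integral_weight_measure[OF assms]
    using disk_bounds by (intro nn_integral_mono mult_right_mono ennreal_leI) auto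
  then show ?thesis using assms by (simp add: nn_integral_cmult)
qed

abbreviation normalized_berezin :: "real \<Rightarrow> real \<Rightarrow> complex measure \<Rightarrow> complex \<Rightarrow> ennreal" where
  "normalized_berezin \<alpha> t \<mu> z \<equiv>
     berezin \<alpha> t \<mu> z / ennreal (\<sigma> (cmod z) * (1 - (cmod z)\<^sup>2) powr (2 - (\<alpha> + 2) * t / 2))"

abbreviation normalized_average :: "real \<Rightarrow> complex measure \<Rightarrow> complex \<Rightarrow> ennreal" where
  "normalized_average R \<mu> z \<equiv> averaging R \<mu> z / ennreal (\<sigma> (cmod z))"

lemma measurable_kernel:
  assumes "sets \<mu> = sets disk_area" "z \<in> disk"
  shows "(\<lambda>w. ennreal (cmod (1 - cnj z * w) powr s)) \<in> borel_measurable \<mu>"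
proof -
  have [measurable]: "(\<lambda>w. cmod (1 - cnj z * w)) \<in> borel_measurable \<mu>"
    by (intro measurable_on_disk assms continuous_intros)
  show ?thesis by measurable
qed

lemma normalized_berezin_eq:
  assumes "sets \<mu> = sets disk_area" "z \<in> disk"
  shows "normalized_berezin \<alpha> t \<mu> z =
    ennreal ((1 - (cmod z)\<^sup>2) powr ((\<alpha> + 2) * t - 2) / \<sigma> (cmod z)) *
      (\<integral>\<^sup>+w. ennreal (cmod (1 - cnj z * w) powr (- ((\<alpha> + 2) * t))) \<partial>\<mu>)" (is "_ = _ * ?I")
proof -
  define s where "s = (\<alpha> + 2) * t"
  define H where "H = 1 - (cmod z)\<^sup>2"
  have H: "H > 0" using assms(2) by (simp add: H_def abs_square_less_1)
  have "berezin \<alpha> t \<mu> z = (\<integral>\<^sup>+w. ennreal (H powr (s / 2)) * ennreal (cmod (1 - cnj z * w) powr (- s)) \<partial>\<mu>)"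
    unfolding berezin_def
    by (intro nn_integral_cong)
       (simp add: norm_normalized_kernel_powr assms space_eq_disk[OF assms(1)] H_def s_def ennreal_mult' del: mem_ball mem_ball_0)
  also have "\<dots> = ennreal (H powr (s / 2)) * ?I"
    unfolding s_def by (intro nn_integral_cmult measurable_kernel assms)
  finally have "normalized_berezin \<alpha> t \<mu> z =
      ennreal (H powr (s / 2) / (\<sigma> (cmod z) * H powr (2 - s / 2))) * ?I"
    using disk_bounds(3)[OF assms(2)] H by (simp add: ennreal_mult_divide H_def s_def)
  also have "H powr (s / 2) / (\<sigma> (cmod z) * H powr (2 - s / 2)) = H powr (s - 2) / \<sigma> (cmod z)"
  proof -
    have "H powr (s - 2) * H powr (2 - s / 2) = H powr (s / 2)" by (simp add: powr_add[symmetric])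
    then show ?thesis using H disk_bounds(3)[OF assms(2)] by (simp add: field_simps)
  qed
  finally show ?thesis by (simp add: H_def s_def)
qed

text \<open>The test function is \<open>g = b\<^sup>1\<^sup>/\<^sup>p (1 - cnj z * w)\<^sup>-\<^sup>s\<^sup>/\<^sup>p\<close>, for which \<open>|g|\<^sup>p\<close> is a multiple of the
integrand of the Berezin transform. The kernel integral bound shows that \<open>b\<close> can be taken of the
order \<open>(1 - |z|)\<^sup>s\<^sup>-\<^sup>2\<close> with \<open>g\<close> still in the unit ball, and this is exactly the size of the normalizing
factor in \<open>normalized_berezin_eq\<close>.\<close>

lemma normalized_berezin_le_carleson_const:
  assumes s: "(\<alpha> + 2) * t > 2" and p: "p > 0"
  obtains K :: real where "K > 0"
    "\<And>\<mu> z. sets \<mu> = sets disk_area \<Longrightarrow> z \<in> disk \<Longrightarrow>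
       normalized_berezin \<alpha> t \<mu> z \<le> ennreal K * carleson_const p \<sigma> \<mu>"
proof -
  define s where "s = (\<alpha> + 2) * t"
  obtain K0 :: real where K0: "K0 > 0" and K0_bound:
    "\<And>z. z \<in> disk \<Longrightarrow> (\<integral>\<^sup>+w. ennreal (cmod (1 - cnj z * w) powr (- s)) \<partial>disk_area)
        \<le> ennreal (K0 * (1 - cmod z) powr (2 - s))"
    using disk_kernel_integral_bound[of s] s unfolding s_def by blast
  define K where "K = 2 powr (s - 2) * K0 * C / c"
  have K: "K > 0" using K0 C_pos c_pos by (simp add: K_def)
  have "normalized_berezin \<alpha> t \<mu> z \<le> ennreal K * carleson_const p \<sigma> \<mu>"
    if \<mu>: "sets \<mu> = sets disk_area" and z: "z \<in> disk" for \<mu> z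
  proof -
    define h where "h = 1 - cmod z"
    have h: "h > 0" using z by (simp add: h_def)
    \<comment> \<open>Chosen such that the integral of \<open>|g|\<^sup>p\<close> against the weight is at most 1.\<close>
    define b where "b = h powr (s - 2) / (K0 * C)"
    have b: "b > 0" using h K0 C_pos by (simp add: b_def)
    define g where "g w = of_real (b powr (1 / p)) * (1 - cnj z * w) powr (of_real (- s / p))" for w
    have hol: "g holomorphic_on disk"
      unfolding g_def
    proof (intro holomorphic_intros)
      fix w assume "w \<in> disk"
      then have "cmod (cnj z * w) < 1"
        using z mult_strict_mono'[of "cmod z" 1 "cmod w" 1] by (simp add: norm_mult)
      then have "Re (1 - cnj z * w) > 0" using complex_Re_le_cmod[of "cnj z * w"] by simp
      then show "1 - cnj z * w \<notin> \<real>\<^sub>\<le>\<^sub>0" by (auto simp: complex_nonpos_Reals_iff)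
    qed
    have gp: "ennreal (cmod (g w) powr p) = ennreal b * ennreal (cmod (1 - cnj z * w) powr (- s))" for w
      using b p by (simp add: g_def norm_mult norm_powr_real_powr' powr_mult powr_powr ennreal_mult')
    have int_g: "(\<integral>\<^sup>+w. ennreal (cmod (g w) powr p) \<partial>\<nu>) =
        ennreal b * (\<integral>\<^sup>+w. ennreal (cmod (1 - cnj z * w) powr (- s)) \<partial>\<nu>)"
      if "sets \<nu> = sets disk_area" for \<nu>
      unfolding gp by (intro nn_integral_cmult measurable_kernel that z)
    have "(\<integral>\<^sup>+w. ennreal (cmod (1 - cnj z * w) powr (- s)) \<partial>weight_measure \<sigma>)
        \<le> ennreal C * (\<integral>\<^sup>+w. ennreal (cmod (1 - cnj z * w) powr (- s)) \<partial>disk_area)"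
      by (intro weight_integral_le measurable_kernel refl z)
    also have "\<dots> \<le> ennreal C * ennreal (K0 * h powr (2 - s))"
      using K0_bound[OF z] unfolding h_def by (rule mult_left_mono) simp
    finally have "(\<integral>\<^sup>+w. ennreal (cmod (g w) powr p) \<partial>weight_measure \<sigma>)
        \<le> ennreal b * (ennreal C * ennreal (K0 * h powr (2 - s)))"
      unfolding int_g[OF sets_weight_measure] by (rule mult_left_mono) simp
    also have "\<dots> = ennreal (b * (C * (K0 * h powr (2 - s))))"
      using b C_pos K0 by (simp add: ennreal_mult')
    also have "b * (C * (K0 * h powr (2 - s))) = 1"
    proof -
      have "h powr (s - 2) * h powr (2 - s) = 1" using h by (simp add: powr_add[symmetric])
      then show ?thesis using C_pos K0 by (simp add: b_def field_simps)
    qed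
    finally have "(\<integral>\<^sup>+w. ennreal (cmod (g w) powr p) \<partial>\<mu>) \<le> carleson_const p \<sigma> \<mu>"
      using carleson_const_upper[OF p hol] by simp
    then have le: "ennreal b * (\<integral>\<^sup>+w. ennreal (cmod (1 - cnj z * w) powr (- s)) \<partial>\<mu>) \<le> carleson_const p \<sigma> \<mu>"
      unfolding int_g[OF \<mu>] .
    have "(1 - (cmod z)\<^sup>2) powr (s - 2) / \<sigma> (cmod z) \<le> (2 * h) powr (s - 2) / c"
    proof (rule frac_le)
      have "1 - (cmod z)\<^sup>2 = (1 + cmod z) * h" by (simp add: h_def power2_eq_square algebra_simps)
      moreover have "(1 + cmod z) * h \<le> 2 * h" using z h by (intro mult_right_mono) auto
      moreover have "0 \<le> (1 + cmod z) * h" using h by simp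
      ultimately show "(1 - (cmod z)\<^sup>2) powr (s - 2) \<le> (2 * h) powr (s - 2)"
        using s by (intro powr_mono2) (auto simp: s_def)
    qed (use c_pos disk_bounds[OF z] in auto)
    also have "\<dots> = K * b"
      using h K0 C_pos c_pos by (simp add: K_def b_def powr_mult)
    finally have "normalized_berezin \<alpha> t \<mu> z \<le>
        ennreal (K * b) * (\<integral>\<^sup>+w. ennreal (cmod (1 - cnj z * w) powr (- s)) \<partial>\<mu>)"
      unfolding normalized_berezin_eq[OF \<mu> z] s_def by (intro mult_right_mono ennreal_leI) auto
    also have "\<dots> = ennreal K * (ennreal b * (\<integral>\<^sup>+w. ennreal (cmod (1 - cnj z * w) powr (- s)) \<partial>\<mu>))"
      using K by (simp add: ennreal_mult' mult.assoc)
    also have "\<dots> \<le> ennreal K * carleson_const p \<sigma> \<mu>" using le by (rule mult_left_mono) simp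
    finally show ?thesis .
  qed
  then show ?thesis using that K by blast
qed

text \<open>On \<open>pseudo_disk z R\<close> the modulus \<open>|1 - cnj z * w|\<close> is at most a multiple of \<open>1 - |z|\<close>. Restricting the Berezin integral
to this disk therefore leaves \<open>\<mu>(pseudo_disk z R) (1 - |z|)\<^sup>-\<^sup>2\<close> up to constants.\<close>

lemma normalized_average_le_berezin:
  assumes s: "(\<alpha> + 2) * t > 2" and R: "R \<in> {0<..<1}"
  obtains K :: real where "K > 0"
    "\<And>\<mu> z. sets \<mu> = sets disk_area \<Longrightarrow> z \<in> disk \<Longrightarrow>
       normalized_average R \<mu> z \<le> ennreal K * normalized_berezin \<alpha> t \<mu> z"
proof -
  define s where "s = (\<alpha> + 2) * t"
  define q where "q = 2 / (1 - R)"
  have q: "q > 0" using R by (simp add: q_def)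
  define K where "K = q powr s / R\<^sup>2"
  have K: "K > 0" using q R by (simp add: K_def)
  have "normalized_average R \<mu> z \<le> ennreal K * normalized_berezin \<alpha> t \<mu> z"
    if \<mu>: "sets \<mu> = sets disk_area" and z: "z \<in> disk" for \<mu> z
  proof -
    define h where "h = 1 - cmod z"
    have h: "h > 0" using z by (simp add: h_def)
    define I where "I = (\<integral>\<^sup>+w. ennreal (cmod (1 - cnj z * w) powr (- s)) \<partial>\<mu>)"
    have "emeasure \<mu> (pseudo_disk z R) = (\<integral>\<^sup>+w. indicator (pseudo_disk z R) w \<partial>\<mu>)"
      using pseudo_disk_in_sets[OF \<mu> z] by simp
    also have "\<dots> \<le> (\<integral>\<^sup>+w. ennreal ((q * h) powr s) * ennreal (cmod (1 - cnj z * w) powr (- s)) \<partial>\<mu>)"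
    proof (intro nn_integral_mono)
      fix w assume "w \<in> space \<mu>"
      then have w: "w \<in> disk" using space_eq_disk[OF \<mu>] by simp
      show "indicator (pseudo_disk z R) w \<le> ennreal ((q * h) powr s) * ennreal (cmod (1 - cnj z * w) powr (- s))"
      proof (cases "w \<in> pseudo_disk z R")
        case True
        have x: "0 < cmod (1 - cnj z * w)" using one_minus_norm_le(1)[OF z w] h by (simp add: h_def del: zero_less_norm_iff)
        have "cmod (1 - cnj z * w) \<le> q * h"
          using pseudo_disk_kernel_bound[OF z _ True] R by (simp add: q_def h_def)
        then have "cmod (1 - cnj z * w) powr s \<le> (q * h) powr s" using s by (intro powr_mono2) (auto simp: s_def)
        then have "1 \<le> (q * h) powr s * cmod (1 - cnj z * w) powr (- s)"
          using x by (simp add: powr_minus field_simps)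
        then have "ennreal 1 \<le> ennreal ((q * h) powr s * cmod (1 - cnj z * w) powr (- s))" by (rule ennreal_leI)
        then show ?thesis using True by (simp add: ennreal_mult')
      qed simp
    qed
    also have "\<dots> = ennreal ((q * h) powr s) * I"
      unfolding I_def by (intro nn_integral_cmult measurable_kernel \<mu> z)
    finally have "averaging R \<mu> z \<le> ennreal (1 / (R * h)\<^sup>2) * (ennreal ((q * h) powr s) * I)"
      using averaging_le_emeasure[OF z R, of \<mu>] unfolding h_def
      by (meson mult_left_mono order_trans zero_le)
    also have "\<dots> = ennreal (1 / (R * h)\<^sup>2 * (q * h) powr s) * I"
      by (subst ennreal_mult') (auto simp: mult.assoc)
    also have "1 / (R * h)\<^sup>2 * (q * h) powr s = K * h powr (s - 2)"
      using h q R by (simp add: K_def powr_mult powr_diff power_mult_distrib)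
    also have "ennreal (K * h powr (s - 2)) * I \<le> ennreal (K * (1 - (cmod z)\<^sup>2) powr (s - 2)) * I"
    proof (intro mult_right_mono ennreal_leI mult_left_mono powr_mono2)
      show "h \<le> 1 - (cmod z)\<^sup>2" using z by (simp add: h_def power2_eq_square mult_left_le_one_le)
    qed (use K h s in \<open>auto simp: s_def\<close>)
    finally have "normalized_average R \<mu> z \<le> ennreal (K * (1 - (cmod z)\<^sup>2) powr (s - 2)) * I / ennreal (\<sigma> (cmod z))"
      by (rule divide_right_mono_ennreal)
    also have "\<dots> = ennreal (K * ((1 - (cmod z)\<^sup>2) powr (s - 2) / \<sigma> (cmod z))) * I"
      using K disk_bounds(3)[OF z] by (simp add: ennreal_mult_divide)
    also have "\<dots> = ennreal K * (ennreal ((1 - (cmod z)\<^sup>2) powr (s - 2) / \<sigma> (cmod z)) * I)"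
      using K by (subst ennreal_mult') (auto simp: mult.assoc)
    also have "ennreal ((1 - (cmod z)\<^sup>2) powr (s - 2) / \<sigma> (cmod z)) * I = normalized_berezin \<alpha> t \<mu> z"
      unfolding I_def s_def by (rule normalized_berezin_eq[OF \<mu> z, symmetric])
    finally show ?thesis .
  qed
  then show ?thesis using that K by blast
qed

lemma measurable_normalized_average:
  assumes "finite_measure \<mu>" "sets \<mu> = sets disk_area"
  shows "normalized_average R \<mu> \<in> borel_measurable disk_area"
proof -
  note [measurable] = measurable_averaging[OF assms]
  show ?thesis by measurable
qed

lemma measurable_normalized_berezin:
  assumes "finite_measure \<mu>" and \<mu>: "sets \<mu> = sets disk_area"
  shows "normalized_berezin \<alpha> t \<mu> \<in> borel_measurable disk_area"
proof -
  interpret finite_measure \<mu> by fact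
  have [measurable]: "(\<lambda>x. x) \<in> borel_measurable disk_area" "(\<lambda>x. x) \<in> borel_measurable \<mu>"
    by (auto intro!: measurable_on_disk \<mu>)
  have [measurable]: "cnj \<in> borel_measurable borel"
    by (intro borel_measurable_continuous_onI continuous_intros)
  have [measurable]: "(\<lambda>z. \<integral>\<^sup>+w. ennreal (cmod (1 - cnj z * w) powr (- ((\<alpha> + 2) * t))) \<partial>\<mu>) \<in> borel_measurable disk_area"
    by (rule borel_measurable_nn_integral) measurable
  have "(\<lambda>z. ennreal ((1 - (cmod z)\<^sup>2) powr ((\<alpha> + 2) * t - 2) / \<sigma> (cmod z)) *
      (\<integral>\<^sup>+w. ennreal (cmod (1 - cnj z * w) powr (- ((\<alpha> + 2) * t))) \<partial>\<mu>)) \<in> borel_measurable disk_area"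
    by measurable
  then show ?thesis
    by (rule measurable_cong[THEN iffD1, rotated]) (simp add: normalized_berezin_eq[OF \<mu>] del: mem_ball mem_ball_0)
qed

lemma measurable_power:
  assumes "f holomorphic_on disk" "sets \<mu> = sets disk_area"
  shows "(\<lambda>w. ennreal (cmod (f w) powr p)) \<in> borel_measurable \<mu>"
proof -
  have [measurable]: "f \<in> borel_measurable \<mu>"
    by (intro measurable_on_disk assms holomorphic_on_imp_continuous_on)
  show ?thesis by measurable
qed

text \<open>In \<open>power_integral_le_averages\<close> the averages appear under an area integral, so an almost everywhere
bound for them is enough, which is what the essential supremum provides.\<close>

lemma carleson_const_le_averages:
  assumes p: "p > 0" and R: "R \<in> {0<..<1}"
  obtains K :: real where "K > 0"
    "\<And>\<mu>. finite_measure \<mu> \<Longrightarrow> sets \<mu> = sets disk_area \<Longrightarrow>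
       carleson_const p \<sigma> \<mu> \<le> ennreal K * esssup disk_area (normalized_average R \<mu>)"
proof -
  obtain K :: real where K: "K > 0" and K_bound:
    "\<And>f \<mu>. f holomorphic_on disk \<Longrightarrow> finite_measure \<mu> \<Longrightarrow> sets \<mu> = sets disk_area \<Longrightarrow>
       (\<integral>\<^sup>+w. ennreal (cmod (f w) powr p) \<partial>\<mu>) \<le>
         ennreal K * (\<integral>\<^sup>+u. ennreal (cmod (f u) powr p) * averaging R \<mu> u \<partial>disk_area)"
    using power_integral_le_averages[OF p R] by blast
  have "carleson_const p \<sigma> \<mu> \<le> ennreal K * esssup disk_area (normalized_average R \<mu>)"
    if fin: "finite_measure \<mu>" and \<mu>: "sets \<mu> = sets disk_area" for \<mu>
  proof (rule carleson_const_least[OF p])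
    fix f assume hol: "f holomorphic_on disk"
      and le1: "(\<integral>\<^sup>+w. ennreal (cmod (f w) powr p) \<partial>weight_measure \<sigma>) \<le> 1"
    define G where "G = esssup disk_area (normalized_average R \<mu>)"
    note [measurable] = measurable_power[OF hol refl, of p]
    have "(\<integral>\<^sup>+u. ennreal (cmod (f u) powr p) * averaging R \<mu> u \<partial>disk_area) \<le>
        (\<integral>\<^sup>+u. G * (ennreal (\<sigma> (cmod u)) * ennreal (cmod (f u) powr p)) \<partial>disk_area)"
    proof (rule nn_integral_mono_AE)
      have "AE u in disk_area. normalized_average R \<mu> u \<le> G" unfolding G_def by (rule esssup_AE)
      moreover have "AE u in disk_area. u \<in> space disk_area" by (rule AE_space)
      ultimately show "AE u in disk_area. ennreal (cmod (f u) powr p) * averaging R \<mu> u \<le>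
          G * (ennreal (\<sigma> (cmod u)) * ennreal (cmod (f u) powr p))"
      proof eventually_elim
        case (elim u)
        then have \<sigma>u: "0 < \<sigma> (cmod u)" using disk_bounds(3)[of u] by simp
        have "averaging R \<mu> u = normalized_average R \<mu> u * ennreal (\<sigma> (cmod u))"
          using \<sigma>u by (simp add: ennreal_divide_times ennreal_divide_self)
        also have "\<dots> \<le> G * ennreal (\<sigma> (cmod u))" using elim(1) by (rule mult_right_mono) simp
        finally have "ennreal (cmod (f u) powr p) * averaging R \<mu> u \<le>
            ennreal (cmod (f u) powr p) * (G * ennreal (\<sigma> (cmod u)))"
          by (rule mult_left_mono) simp
        then show ?case by (simp only: mult_ac)
      qed
    qed
    also have "\<dots> = G * (\<integral>\<^sup>+u. ennreal (\<sigma> (cmod u)) * ennreal (cmod (f u) powr p) \<partial>disk_area)"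
      by (rule nn_integral_cmult) measurable
    also have "\<dots> \<le> G * 1"
      using le1 unfolding nn_integral_weight_measure[OF measurable_power[OF hol refl]]
      by (rule mult_left_mono) simp
    finally have "(\<integral>\<^sup>+u. ennreal (cmod (f u) powr p) * averaging R \<mu> u \<partial>disk_area) \<le> G" by simp
    then show "(\<integral>\<^sup>+w. ennreal (cmod (f w) powr p) \<partial>\<mu>) \<le> ennreal K * G"
      using K_bound[OF hol fin \<mu>] by (meson mult_left_mono order_trans zero_le)
  qed
  then show ?thesis using that K by blast
qed

lemma carleson_const_le_lattice_averages:
  assumes p: "p > 0" and r: "r \<in> {0<..<1}" and lat: "is_lattice r z"
  obtains K :: real where "K > 0"
    "\<And>\<mu>. sets \<mu> = sets disk_area \<Longrightarrow>
       carleson_const p \<sigma> \<mu> \<le> ennreal K * (SUP k. normalized_average r \<mu> (z k))"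
proof -
  obtain K :: real where K: "K > 0" and K_bound:
    "\<And>f \<mu> L. f holomorphic_on disk \<Longrightarrow> sets \<mu> = sets disk_area \<Longrightarrow>
       (\<And>k. averaging r \<mu> (z k) \<le> L) \<Longrightarrow>
       (\<integral>\<^sup>+w. ennreal (cmod (f w) powr p) \<partial>\<mu>) \<le>
         ennreal K * (L * (\<integral>\<^sup>+u. ennreal (cmod (f u) powr p) \<partial>disk_area))"
    using power_integral_le_lattice_averages[OF p r lat] by blast
  have zd: "z k \<in> disk" for k using lat unfolding is_lattice_def by blast
  have "carleson_const p \<sigma> \<mu> \<le> ennreal (K * (C / c)) * (SUP k. normalized_average r \<mu> (z k))"
    if \<mu>: "sets \<mu> = sets disk_area" for \<mu>
  proof (rule carleson_const_least[OF p])
    fix f assume hol: "f holomorphic_on disk"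
      and le1: "(\<integral>\<^sup>+w. ennreal (cmod (f w) powr p) \<partial>weight_measure \<sigma>) \<le> 1"
    define S where "S = (SUP k. normalized_average r \<mu> (z k))"
    define J where "J = (\<integral>\<^sup>+u. ennreal (cmod (f u) powr p) \<partial>disk_area)"
    have "averaging r \<mu> (z k) \<le> S * ennreal C" for k
    proof -
      have "averaging r \<mu> (z k) = normalized_average r \<mu> (z k) * ennreal (\<sigma> (cmod (z k)))"
        using disk_bounds(3)[OF zd, of k] by (simp add: ennreal_divide_times ennreal_divide_self)
      also have "\<dots> \<le> S * ennreal C"
        unfolding S_def using disk_bounds(2)[OF zd, of k] by (intro mult_mono SUP_upper ennreal_leI) auto
      finally show ?thesis .
    qed
    from K_bound[OF hol \<mu> this]
    have "(\<integral>\<^sup>+w. ennreal (cmod (f w) powr p) \<partial>\<mu>) \<le> ennreal K * (S * ennreal C * J)"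
      unfolding J_def .
    also have "\<dots> \<le> ennreal K * (S * ennreal C * ennreal (1 / c))"
    proof (intro mult_left_mono)
      have "ennreal c * J \<le> 1"
        unfolding J_def using area_integral_le[OF measurable_power[OF hol refl]] le1 by (rule order_trans)
      then have "ennreal (1 / c) * (ennreal c * J) \<le> ennreal (1 / c) * 1" by (rule mult_left_mono) simp
      moreover have "ennreal (1 / c) * (ennreal c * J) = J"
        using c_pos by (simp add: mult.assoc[symmetric] ennreal_mult'[symmetric])
      ultimately show "J \<le> ennreal (1 / c)" by simp
    qed auto
    also have "\<dots> = ennreal K * (ennreal C * ennreal (1 / c)) * S" by (simp only: mult_ac)
    also have "ennreal K * (ennreal C * ennreal (1 / c)) = ennreal (K * (C / c))"
      using K C_pos c_pos by (simp add: ennreal_mult'[symmetric])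
    finally show "(\<integral>\<^sup>+w. ennreal (cmod (f w) powr p) \<partial>\<mu>) \<le> ennreal (K * (C / c)) * S" .
  qed
  moreover have "K * (C / c) > 0" using K C_pos c_pos by simp
  ultimately show ?thesis using that[of "K * (C / c)"] by blast
qed

end

section \<open>Powers of a weighted composition operator\<close>

lemma SUP_le_mult_SUP:
  fixes f g :: "nat \<Rightarrow> ennreal"
  assumes "\<And>n. f n \<le> K * g n"
  shows "(SUP n\<in>N. f n) \<le> K * (SUP n\<in>N. g n)"
proof (rule SUP_least)
  fix n assume "n \<in> N"
  then have "g n \<le> (SUP n\<in>N. g n)" by (rule SUP_upper)
  then have "K * g n \<le> K * (SUP n\<in>N. g n)" by (rule mult_left_mono) simp
  then show "f n \<le> K * (SUP n\<in>N. g n)" by (rule order_trans[OF assms])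
qed

lemma iterate_self_map:
  assumes "\<phi> holomorphic_on disk" "\<phi> ` disk \<subseteq> disk"
  shows "(\<phi> ^^ n) holomorphic_on disk \<and> (\<phi> ^^ n) ` disk \<subseteq> disk"
proof (induction n)
  case (Suc n)
  have "(\<phi> \<circ> (\<phi> ^^ n)) holomorphic_on disk"
    using Suc assms(1) by (intro holomorphic_on_compose_gen[of _ _ _ disk]) auto
  moreover have "(\<phi> \<circ> (\<phi> ^^ n)) ` disk \<subseteq> disk"
    using Suc assms(2) by (simp only: image_comp[symmetric]) blast
  ultimately show ?case by (simp only: funpow.simps(2))
qed (simp add: holomorphic_on_id)

lemma holomorphic_weight_cocycle:
  assumes "\<psi> holomorphic_on disk" "\<phi> holomorphic_on disk" "\<phi> ` disk \<subseteq> disk"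
  shows "weight_cocycle \<psi> \<phi> n holomorphic_on disk"
proof -
  have "\<psi> \<circ> (\<phi> ^^ j) holomorphic_on disk" for j
    using iterate_self_map[OF assms(2,3), of j] assms(1)
    by (intro holomorphic_on_compose_gen[of _ _ _ disk]) auto
  then have "(\<lambda>z. \<Prod>j<n. (\<psi> \<circ> (\<phi> ^^ j)) z) holomorphic_on disk" by (rule holomorphic_on_prod)
  then show ?thesis unfolding weight_cocycle_def[abs_def] o_apply .
qed

lemma wcomp_funpow:
  "(wcomp \<psi> \<phi> ^^ n) f z = weight_cocycle \<psi> \<phi> n z * f ((\<phi> ^^ n) z)"
proof (induction n arbitrary: z)
  case (Suc n)
  have "weight_cocycle \<psi> \<phi> (Suc n) z = \<psi> z * weight_cocycle \<psi> \<phi> n (\<phi> z)"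
    unfolding weight_cocycle_def
    by (subst prod.lessThan_Suc_shift) (simp add: funpow_swap1)
  moreover have "(wcomp \<psi> \<phi> ^^ Suc n) f z = \<psi> z * (wcomp \<psi> \<phi> ^^ n) f (\<phi> z)"
    by (simp add: wcomp_def[of \<psi> \<phi> "(wcomp \<psi> \<phi> ^^ n) f"])
  moreover have "(\<phi> ^^ Suc n) z = (\<phi> ^^ n) (\<phi> z)"
    by (simp add: funpow_swap1)
  ultimately show ?case by (simp only: Suc mult.assoc)
qed (simp add: weight_cocycle_def)

context bounded_weight
begin

lemma bergman_space_iff:
  "f \<in> bergman_space p \<sigma> \<longleftrightarrow>
    f holomorphic_on disk \<and> (\<integral>\<^sup>+w. ennreal (cmod (f w) powr p) \<partial>weight_measure \<sigma>) < \<infinity>"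
  by (simp add: bergman_space_def Lp_norm_def epowr_less_infinity_iff[unfolded infinity_ennreal_def])

lemma wcomp_in_bergman_space:
  assumes "bounded_wcomp p \<sigma> \<psi> \<phi>" "f \<in> bergman_space p \<sigma>"
  shows "wcomp \<psi> \<phi> f \<in> bergman_space p \<sigma>"
proof -
  obtain B where B: "Lp_norm p (weight_measure \<sigma>) (wcomp \<psi> \<phi> f) \<le> ennreal B * Lp_norm p (weight_measure \<sigma>) f"
    using assms unfolding bounded_wcomp_def bounded_op_def by blast
  have "Lp_norm p (weight_measure \<sigma>) f < \<infinity>" using assms(2) by (simp add: bergman_space_def)
  then have "ennreal B * Lp_norm p (weight_measure \<sigma>) f < \<infinity>" by (simp add: ennreal_mult_less_top)
  with B have "Lp_norm p (weight_measure \<sigma>) (wcomp \<psi> \<phi> f) < \<infinity>" by (rule order.strict_trans1)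
  moreover have "wcomp \<psi> \<phi> f holomorphic_on disk"
  proof -
    have "f \<circ> \<phi> holomorphic_on disk"
      using assms by (intro holomorphic_on_compose_gen[of _ _ _ disk]) (auto simp: bounded_wcomp_def bergman_space_def)
    then have "(\<lambda>z. \<psi> z * (f \<circ> \<phi>) z) holomorphic_on disk"
      by (rule holomorphic_on_mult[rotated]) (use assms(1) in \<open>simp add: bounded_wcomp_def\<close>)
    then show ?thesis by (simp add: wcomp_def)
  qed
  ultimately show ?thesis by (simp add: bergman_space_def)
qed

lemma one_in_bergman_space: "(\<lambda>_. 1) \<in> bergman_space p \<sigma>"
proof -
  have "(\<integral>\<^sup>+w. 1 \<partial>weight_measure \<sigma>) \<le> ennreal C * (\<integral>\<^sup>+w. 1 \<partial>disk_area)"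
    by (rule weight_integral_le) simp
  also have "\<dots> < \<infinity>"
    using finite_measure.emeasure_finite[OF finite_measure_disk_area, of disk]
    by (simp add: ennreal_mult_less_top less_top)
  finally show ?thesis by (simp add: bergman_space_iff)
qed

lemma sets_iterate_measure: "sets (iterate_measure p \<sigma> \<psi> \<phi> n) = sets disk_area"
  unfolding iterate_measure_def sets_distr by (rule sets_disk_area[symmetric])

text \<open>Change of variables for the image measure \<open>\<Omega>\<^sub>n\<close>, which turns the norm of \<open>C\<^sup>n f\<close> into a norm of \<open>f\<close>
itself.\<close>

lemma nn_integral_iterate_measure:
  assumes bw: "bounded_wcomp p \<sigma> \<psi> \<phi>" and p: "p > 0" and f: "f holomorphic_on disk"
  shows "(\<integral>\<^sup>+w. ennreal (cmod (f w) powr p) \<partial>iterate_measure p \<sigma> \<psi> \<phi> n) =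
    (\<integral>\<^sup>+z. ennreal (cmod ((wcomp \<psi> \<phi> ^^ n) f z) powr p) \<partial>weight_measure \<sigma>)"
proof -
  have \<phi>: "\<phi> holomorphic_on disk" "\<phi> ` disk \<subseteq> disk" and \<psi>: "\<psi> holomorphic_on disk"
    using bw by (auto simp: bounded_wcomp_def)
  have it: "(\<phi> ^^ n) holomorphic_on disk" "(\<phi> ^^ n) ` disk \<subseteq> disk"
    using iterate_self_map[OF \<phi>, of n] by auto
  define J where "J z = ennreal (cmod (weight_cocycle \<psi> \<phi> n z) powr p)" for z
  have Jm: "J \<in> borel_measurable (weight_measure \<sigma>)"
    unfolding J_def by (rule measurable_power[OF holomorphic_weight_cocycle[OF \<psi> \<phi>] sets_weight_measure])
  have \<phi>m: "(\<phi> ^^ n) \<in> density (weight_measure \<sigma>) J \<rightarrow>\<^sub>M restrict_space borel disk"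
  proof (rule measurable_restrict_space2)
    show "(\<phi> ^^ n) \<in> space (density (weight_measure \<sigma>) J) \<rightarrow> disk"
      using it(2) space_eq_disk[OF sets_weight_measure] by auto
    show "(\<phi> ^^ n) \<in> borel_measurable (density (weight_measure \<sigma>) J)"
      by (intro measurable_on_disk holomorphic_on_imp_continuous_on it) (simp add: sets_weight_measure)
  qed
  have "(\<integral>\<^sup>+w. ennreal (cmod (f w) powr p) \<partial>iterate_measure p \<sigma> \<psi> \<phi> n) =
      (\<integral>\<^sup>+z. ennreal (cmod (f ((\<phi> ^^ n) z)) powr p) \<partial>density (weight_measure \<sigma>) J)"
    unfolding iterate_measure_def J_def[symmetric]
    by (intro nn_integral_distr \<phi>m measurable_power f) (simp add: sets_disk_area)
  also have "\<dots> = (\<integral>\<^sup>+z. J z * ennreal (cmod (f ((\<phi> ^^ n) z)) powr p) \<partial>weight_measure \<sigma>)"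
  proof (rule nn_integral_density[OF Jm])
    have "f \<circ> (\<phi> ^^ n) holomorphic_on disk" using it f by (intro holomorphic_on_compose_gen[of _ _ _ disk]) auto
    from measurable_power[OF this sets_weight_measure]
    show "(\<lambda>z. ennreal (cmod (f ((\<phi> ^^ n) z)) powr p)) \<in> borel_measurable (weight_measure \<sigma>)"
      by simp
  qed
  also have "\<dots> = (\<integral>\<^sup>+z. ennreal (cmod ((wcomp \<psi> \<phi> ^^ n) f z) powr p) \<partial>weight_measure \<sigma>)"
    by (intro nn_integral_cong) (simp add: J_def wcomp_funpow norm_mult powr_mult ennreal_mult')
  finally show ?thesis .
qed

text \<open>The total mass is \<open>\<parallel>C\<^sup>n 1\<parallel>\<^sup>p\<close>, and \<open>C\<close> maps the Bergman space into itself. Finiteness is what makes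
Fubini's theorem and the measurability of the transforms of \<open>\<Omega>\<^sub>n\<close> available.\<close>

lemma finite_iterate_measure:
  assumes bw: "bounded_wcomp p \<sigma> \<psi> \<phi>" and p: "p > 0"
  shows "finite_measure (iterate_measure p \<sigma> \<psi> \<phi> n)"
proof (rule finite_measureI)
  have "(wcomp \<psi> \<phi> ^^ n) (\<lambda>_. 1) \<in> bergman_space p \<sigma>"
  proof (induction n)
    case 0
    show ?case unfolding funpow_0 by (rule one_in_bergman_space)
  next
    case (Suc n)
    show ?case unfolding funpow.simps(2) o_apply by (rule wcomp_in_bergman_space[OF bw Suc])
  qed
  then have "(\<integral>\<^sup>+z. ennreal (cmod ((wcomp \<psi> \<phi> ^^ n) (\<lambda>_. 1) z) powr p) \<partial>weight_measure \<sigma>) < \<infinity>"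
    unfolding bergman_space_iff by (rule conjunct2)
  then have "(\<integral>\<^sup>+w. ennreal (cmod 1 powr p) \<partial>iterate_measure p \<sigma> \<psi> \<phi> n) < \<infinity>"
    using nn_integral_iterate_measure[OF bw p holomorphic_on_const[of 1], of n] by (simp only:)
  then show "emeasure (iterate_measure p \<sigma> \<psi> \<phi> n) (space (iterate_measure p \<sigma> \<psi> \<phi> n)) \<noteq> \<infinity>"
    by simp
qed

lemma op_norm_power_eq_carleson_const:
  assumes bw: "bounded_wcomp p \<sigma> \<psi> \<phi>" and p: "p > 0"
  shows "epowr (op_norm p \<sigma> (wcomp \<psi> \<phi> ^^ n)) p = carleson_const p \<sigma> (iterate_measure p \<sigma> \<psi> \<phi> n)"
proof -
  define U where "U = {f \<in> bergman_space p \<sigma>. Lp_norm p (weight_measure \<sigma>) f \<le> 1}"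
  have "op_norm p \<sigma> (wcomp \<psi> \<phi> ^^ n) =
      (SUP f\<in>U. epowr (\<integral>\<^sup>+w. ennreal (cmod (f w) powr p) \<partial>iterate_measure p \<sigma> \<psi> \<phi> n) (1 / p))"
    unfolding op_norm_def U_def[symmetric]
  proof (rule SUP_cong[OF refl])
    fix f assume "f \<in> U"
    then have "f holomorphic_on disk" by (simp add: U_def bergman_space_def)
    from nn_integral_iterate_measure[OF bw p this]
    show "Lp_norm p (weight_measure \<sigma>) ((wcomp \<psi> \<phi> ^^ n) f) =
        epowr (\<integral>\<^sup>+w. ennreal (cmod (f w) powr p) \<partial>iterate_measure p \<sigma> \<psi> \<phi> n) (1 / p)"
      by (simp only: Lp_norm_def)
  qed
  then show ?thesis by (simp only: epowr_SUP[OF p] carleson_const_def U_def)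
qed

lemma Q1_eq:
  assumes "bounded_wcomp p \<sigma> \<psi> \<phi>" and "p > 0"
  shows "Q1 p \<sigma> \<psi> \<phi> = (SUP n\<in>{1..}. carleson_const p \<sigma> (iterate_measure p \<sigma> \<psi> \<phi> n))"
  unfolding Q1_def by (simp add: op_norm_power_eq_carleson_const[OF assms])

lemma Q2_le_Q1:
  assumes "(\<alpha> + 2) * t > 2" "p > 0"
  obtains K :: real where "K > 0"
    "\<And>\<psi> \<phi>. bounded_wcomp p \<sigma> \<psi> \<phi> \<Longrightarrow> Q2 \<alpha> t p \<sigma> \<psi> \<phi> \<le> ennreal K * Q1 p \<sigma> \<psi> \<phi>"
proof -
  obtain K :: real where K: "K > 0" and le:
    "\<And>\<mu> z. sets \<mu> = sets disk_area \<Longrightarrow> z \<in> disk \<Longrightarrow>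
       normalized_berezin \<alpha> t \<mu> z \<le> ennreal K * carleson_const p \<sigma> \<mu>"
    using normalized_berezin_le_carleson_const[OF assms] by blast
  have "Q2 \<alpha> t p \<sigma> \<psi> \<phi> \<le> ennreal K * Q1 p \<sigma> \<psi> \<phi>" if bw: "bounded_wcomp p \<sigma> \<psi> \<phi>" for \<psi> \<phi>
    unfolding Q2_def Q1_eq[OF bw assms(2)]
  proof (rule SUP_le_mult_SUP, rule esssup_I)
    fix n
    let ?\<mu> = "iterate_measure p \<sigma> \<psi> \<phi> n"
    show "normalized_berezin \<alpha> t ?\<mu> \<in> borel_measurable disk_area"
      by (rule measurable_normalized_berezin[OF finite_iterate_measure[OF bw assms(2)] sets_iterate_measure])
    show "AE z in disk_area. normalized_berezin \<alpha> t ?\<mu> z \<le> ennreal K * carleson_const p \<sigma> ?\<mu>"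
      by (rule AE_I2, rule le[OF sets_iterate_measure]) simp
  qed
  then show ?thesis using that K by blast
qed

lemma Q3_le_Q2:
  assumes "(\<alpha> + 2) * t > 2" "p > 0" "R \<in> {0<..<1}"
  obtains K :: real where "K > 0"
    "\<And>\<psi> \<phi>. bounded_wcomp p \<sigma> \<psi> \<phi> \<Longrightarrow> Q3 R p \<sigma> \<psi> \<phi> \<le> ennreal K * Q2 \<alpha> t p \<sigma> \<psi> \<phi>"
proof -
  obtain K :: real where K: "K > 0" and le:
    "\<And>\<mu> z. sets \<mu> = sets disk_area \<Longrightarrow> z \<in> disk \<Longrightarrow>
       normalized_average R \<mu> z \<le> ennreal K * normalized_berezin \<alpha> t \<mu> z"
    using normalized_average_le_berezin[OF assms(1,3)] by blast
  have "Q3 R p \<sigma> \<psi> \<phi> \<le> ennreal K * Q2 \<alpha> t p \<sigma> \<psi> \<phi>" if bw: "bounded_wcomp p \<sigma> \<psi> \<phi>" for \<psi> \<phi>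
    unfolding Q2_def Q3_def
  proof (rule SUP_le_mult_SUP, rule esssup_I)
    fix n
    let ?\<mu> = "iterate_measure p \<sigma> \<psi> \<phi> n"
    show "normalized_average R ?\<mu> \<in> borel_measurable disk_area"
      by (rule measurable_normalized_average[OF finite_iterate_measure[OF bw assms(2)] sets_iterate_measure])
    have "AE z in disk_area. normalized_berezin \<alpha> t ?\<mu> z \<le> esssup disk_area (normalized_berezin \<alpha> t ?\<mu>)"
      by (rule esssup_AE)
    moreover have "AE z in disk_area. z \<in> space disk_area" by (rule AE_space)
    ultimately show "AE z in disk_area. normalized_average R ?\<mu> z \<le>
        ennreal K * esssup disk_area (normalized_berezin \<alpha> t ?\<mu>)"
    proof eventually_elim
      case (elim z)
      have "normalized_average R ?\<mu> z \<le> ennreal K * normalized_berezin \<alpha> t ?\<mu> z"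
        using elim(2) by (intro le sets_iterate_measure) simp
      also have "\<dots> \<le> ennreal K * esssup disk_area (normalized_berezin \<alpha> t ?\<mu>)"
        using elim(1) by (rule mult_left_mono) simp
      finally show ?case .
    qed
  qed
  then show ?thesis using that K by blast
qed

lemma Q1_le_Q3:
  assumes "p > 0" "R \<in> {0<..<1}"
  obtains K :: real where "K > 0"
    "\<And>\<psi> \<phi>. bounded_wcomp p \<sigma> \<psi> \<phi> \<Longrightarrow> Q1 p \<sigma> \<psi> \<phi> \<le> ennreal K * Q3 R p \<sigma> \<psi> \<phi>"
proof -
  obtain K :: real where K: "K > 0" and le:
    "\<And>\<mu>. finite_measure \<mu> \<Longrightarrow> sets \<mu> = sets disk_area \<Longrightarrow>
       carleson_const p \<sigma> \<mu> \<le> ennreal K * esssup disk_area (normalized_average R \<mu>)"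
    using carleson_const_le_averages[OF assms] by blast
  have "Q1 p \<sigma> \<psi> \<phi> \<le> ennreal K * Q3 R p \<sigma> \<psi> \<phi>" if bw: "bounded_wcomp p \<sigma> \<psi> \<phi>" for \<psi> \<phi>
    unfolding Q3_def Q1_eq[OF bw assms(1)]
    by (rule SUP_le_mult_SUP, rule le[OF finite_iterate_measure[OF bw assms(1)] sets_iterate_measure])
  then show ?thesis using that K by blast
qed

lemma Q4_le_Q1:
  assumes "p > 0" "r \<in> {0<..<1}"
  obtains K :: real where "K > 0"
    "\<And>\<psi> \<phi> z. bounded_wcomp p \<sigma> \<psi> \<phi> \<Longrightarrow> is_lattice r z \<Longrightarrow> Q4 r z p \<sigma> \<psi> \<phi> \<le> ennreal K * Q1 p \<sigma> \<psi> \<phi>"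
proof -
  \<comment> \<open>Averages and operator norm do not see the kernel, so any exponent \<open>(\<alpha> + 2) * t > 2\<close>
    may serve as a bridge between them; here \<open>\<alpha> = t = 1\<close>.\<close>
  have s: "(1 + 2) * 1 > (2::real)" by simp
  obtain K1 :: real where K1: "K1 > 0" and le1:
    "\<And>\<mu> z. sets \<mu> = sets disk_area \<Longrightarrow> z \<in> disk \<Longrightarrow>
       normalized_berezin 1 1 \<mu> z \<le> ennreal K1 * carleson_const p \<sigma> \<mu>"
    using normalized_berezin_le_carleson_const[OF s assms(1)] by blast
  obtain K2 :: real where K2: "K2 > 0" and le2:
    "\<And>\<mu> z. sets \<mu> = sets disk_area \<Longrightarrow> z \<in> disk \<Longrightarrow>
       normalized_average r \<mu> z \<le> ennreal K2 * normalized_berezin 1 1 \<mu> z"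
    using normalized_average_le_berezin[OF s assms(2)] by blast
  have "Q4 r z p \<sigma> \<psi> \<phi> \<le> ennreal (K2 * K1) * Q1 p \<sigma> \<psi> \<phi>"
    if bw: "bounded_wcomp p \<sigma> \<psi> \<phi>" and lat: "is_lattice r z" for \<psi> \<phi> z
    unfolding Q4_def Q1_eq[OF bw assms(1)]
  proof (rule SUP_le_mult_SUP, rule SUP_least)
    fix n k
    let ?\<mu> = "iterate_measure p \<sigma> \<psi> \<phi> n"
    have z: "z k \<in> disk" using lat unfolding is_lattice_def by blast
    have "normalized_average r ?\<mu> (z k) \<le> ennreal K2 * normalized_berezin 1 1 ?\<mu> (z k)"
      by (intro le2 sets_iterate_measure z)
    also have "\<dots> \<le> ennreal K2 * (ennreal K1 * carleson_const p \<sigma> ?\<mu>)"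
      by (intro mult_left_mono le1 sets_iterate_measure z) simp
    also have "\<dots> = ennreal (K2 * K1) * carleson_const p \<sigma> ?\<mu>"
      using K2 by (simp add: ennreal_mult' mult.assoc)
    finally show "normalized_average r ?\<mu> (z k) \<le> ennreal (K2 * K1) * carleson_const p \<sigma> ?\<mu>" .
  qed
  moreover have "K2 * K1 > 0" using K1 K2 by simp
  ultimately show ?thesis using that by blast
qed

lemma Q1_le_Q4:
  assumes "p > 0" "r \<in> {0<..<1}" "is_lattice r z"
  obtains K :: real where "K > 0"
    "\<And>\<psi> \<phi>. bounded_wcomp p \<sigma> \<psi> \<phi> \<Longrightarrow> Q1 p \<sigma> \<psi> \<phi> \<le> ennreal K * Q4 r z p \<sigma> \<psi> \<phi>"
proof -
  obtain K :: real where K: "K > 0" and le: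
    "\<And>\<mu>. sets \<mu> = sets disk_area \<Longrightarrow>
       carleson_const p \<sigma> \<mu> \<le> ennreal K * (SUP k. normalized_average r \<mu> (z k))"
    using carleson_const_le_lattice_averages[OF assms] by blast
  have "Q1 p \<sigma> \<psi> \<phi> \<le> ennreal K * Q4 r z p \<sigma> \<psi> \<phi>" if bw: "bounded_wcomp p \<sigma> \<psi> \<phi>" for \<psi> \<phi>
    unfolding Q4_def Q1_eq[OF bw assms(1)]
    by (rule SUP_le_mult_SUP, rule le[OF sets_iterate_measure])
  then show ?thesis using that K by blast
qed

end

lemma uniformly_comparableI:
  assumes "K > 0" "L > 0" "\<And>\<psi> \<phi>. H \<psi> \<phi> \<Longrightarrow> X \<psi> \<phi> \<le> ennreal K * Y \<psi> \<phi>"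
    "\<And>\<psi> \<phi>. H \<psi> \<phi> \<Longrightarrow> Y \<psi> \<phi> \<le> ennreal L * X \<psi> \<phi>"
  shows "uniformly_comparable H X Y"
  unfolding uniformly_comparable_def
proof (intro exI[of _ "max K L"] conjI allI impI)
  fix \<psi> \<phi> assume H: "H \<psi> \<phi>"
  have "ennreal K * Y \<psi> \<phi> \<le> ennreal (max K L) * Y \<psi> \<phi>" "ennreal L * X \<psi> \<phi> \<le> ennreal (max K L) * X \<psi> \<phi>"
    by (intro mult_right_mono ennreal_leI; simp)+
  then show "X \<psi> \<phi> \<le> ennreal (max K L) * Y \<psi> \<phi>" "Y \<psi> \<phi> \<le> ennreal (max K L) * X \<psi> \<phi>"
    using assms(3,4)[OF H] by (blast intro: order_trans)+
qed (use assms in simp)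

lemma uniformly_comparable_sym: "uniformly_comparable H X Y \<Longrightarrow> uniformly_comparable H Y X"
  unfolding uniformly_comparable_def by blast

lemma uniformly_comparable_trans:
  assumes "uniformly_comparable H X Y" "uniformly_comparable H Y Z"
  shows "uniformly_comparable H X Z"
proof -
  obtain K where K: "K > 0" "\<And>\<psi> \<phi>. H \<psi> \<phi> \<Longrightarrow> X \<psi> \<phi> \<le> ennreal K * Y \<psi> \<phi>" "\<And>\<psi> \<phi>. H \<psi> \<phi> \<Longrightarrow> Y \<psi> \<phi> \<le> ennreal K * X \<psi> \<phi>"
    using assms(1) unfolding uniformly_comparable_def by blast
  obtain L where L: "L > 0" "\<And>\<psi> \<phi>. H \<psi> \<phi> \<Longrightarrow> Y \<psi> \<phi> \<le> ennreal L * Z \<psi> \<phi>" "\<And>\<psi> \<phi>. H \<psi> \<phi> \<Longrightarrow> Z \<psi> \<phi> \<le> ennreal L * Y \<psi> \<phi>"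
    using assms(2) unfolding uniformly_comparable_def by blast
  show ?thesis
  proof (rule uniformly_comparableI[of "K * L" "K * L"])
    fix \<psi> \<phi> assume H: "H \<psi> \<phi>"
    have eq: "ennreal (K * L) = ennreal K * ennreal L" using K by (simp add: ennreal_mult')
    have "X \<psi> \<phi> \<le> ennreal K * (ennreal L * Z \<psi> \<phi>)"
      using K(2)[OF H] L(2)[OF H] by (meson mult_left_mono order_trans zero_le)
    then show "X \<psi> \<phi> \<le> ennreal (K * L) * Z \<psi> \<phi>" by (simp add: eq mult.assoc)
    have "Z \<psi> \<phi> \<le> ennreal L * (ennreal K * X \<psi> \<phi>)"
      using L(3)[OF H] K(3)[OF H] by (meson mult_left_mono order_trans zero_le)
    then show "Z \<psi> \<phi> \<le> ennreal (K * L) * X \<psi> \<phi>" by (simp add: eq mult_ac)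
  qed (use K(1) L(1) in simp_all)
qed

lemma uniformly_comparable_finite_iff:
  assumes "uniformly_comparable H X Y" "H \<psi> \<phi>"
  shows "X \<psi> \<phi> < \<infinity> \<longleftrightarrow> Y \<psi> \<phi> < \<infinity>"
proof -
  obtain K where "X \<psi> \<phi> \<le> ennreal K * Y \<psi> \<phi>" "Y \<psi> \<phi> \<le> ennreal K * X \<psi> \<phi>"
    using assms unfolding uniformly_comparable_def by blast
  then show ?thesis by (auto simp: ennreal_mult_less_top intro: order.strict_trans1)
qed

theorem corollary1:
  fixes \<sigma> :: "real \<Rightarrow> real" and \<alpha> p t :: real
  assumes "admissible_weight \<sigma>" and "\<alpha> > -1" and "0 < p" and "t > 2 / (\<alpha> + 2)"
  shows
    "(\<forall>\<psi> \<phi>. bounded_wcomp p \<sigma> \<psi> \<phi> \<longrightarrow>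
        (Q1 p \<sigma> \<psi> \<phi> < \<infinity> \<longleftrightarrow> Q2 \<alpha> t p \<sigma> \<psi> \<phi> < \<infinity>) \<and>
        (Q1 p \<sigma> \<psi> \<phi> < \<infinity> \<longleftrightarrow> (\<exists>R\<in>{0<..<1}. Q3 R p \<sigma> \<psi> \<phi> < \<infinity>)) \<and>
        (Q1 p \<sigma> \<psi> \<phi> < \<infinity> \<longleftrightarrow> (\<forall>R\<in>{0<..<1}. Q3 R p \<sigma> \<psi> \<phi> < \<infinity>)) \<and>
        (\<forall>r\<in>{0<..<1}.
           (Q1 p \<sigma> \<psi> \<phi> < \<infinity> \<longleftrightarrow> (\<exists>z. is_lattice r z \<and> Q4 r z p \<sigma> \<psi> \<phi> < \<infinity>)) \<and>
           (Q1 p \<sigma> \<psi> \<phi> < \<infinity> \<longleftrightarrow> (\<forall>z. is_lattice r z \<longrightarrow> Q4 r z p \<sigma> \<psi> \<phi> < \<infinity>)))) \<and>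
     uniformly_comparable (bounded_wcomp p \<sigma>) (Q1 p \<sigma>) (Q2 \<alpha> t p \<sigma>) \<and>
     (\<forall>R\<in>{0<..<1}. uniformly_comparable (bounded_wcomp p \<sigma>) (Q2 \<alpha> t p \<sigma>) (Q3 R p \<sigma>)) \<and>
     (\<forall>R\<in>{0<..<1}. \<forall>r\<in>{0<..<1}. \<forall>z. is_lattice r z \<longrightarrow>
        uniformly_comparable (bounded_wcomp p \<sigma>) (Q3 R p \<sigma>) (Q4 r z p \<sigma>))"
proof -
  obtain c C where "0 < c" "continuous_on {0..1} \<sigma>" "\<And>x. x \<in> {0..1} \<Longrightarrow> c \<le> \<sigma> x \<and> \<sigma> x \<le> C"
    using admissible_weight_bounds[OF assms(1)] by metis
  then interpret bounded_weight \<sigma> c C by unfold_locales auto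
  have s: "(\<alpha> + 2) * t > 2" using assms(2,4) by (simp add: field_simps)
  note p = assms(3)
  \<comment> \<open>The cycle \<open>Q2 \<lesssim> Q1 \<lesssim> Q3 \<lesssim> Q2\<close> makes the first three quantities comparable, and \<open>Q4\<close> is
    compared with \<open>Q1\<close> directly.\<close>
  let ?H = "bounded_wcomp p \<sigma>"
  obtain K21 where K21: "K21 > 0" "\<And>\<psi> \<phi>. ?H \<psi> \<phi> \<Longrightarrow> Q2 \<alpha> t p \<sigma> \<psi> \<phi> \<le> ennreal K21 * Q1 p \<sigma> \<psi> \<phi>"
    using Q2_le_Q1[OF s p] by blast
  have c12_c13: "uniformly_comparable ?H (Q1 p \<sigma>) (Q2 \<alpha> t p \<sigma>) \<and> uniformly_comparable ?H (Q1 p \<sigma>) (Q3 R p \<sigma>)"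
    if R: "R \<in> {0<..<1}" for R
  proof -
    obtain K32 where K32: "K32 > 0" "\<And>\<psi> \<phi>. ?H \<psi> \<phi> \<Longrightarrow> Q3 R p \<sigma> \<psi> \<phi> \<le> ennreal K32 * Q2 \<alpha> t p \<sigma> \<psi> \<phi>"
      using Q3_le_Q2[OF s p R] by blast
    obtain K13 where K13: "K13 > 0" "\<And>\<psi> \<phi>. ?H \<psi> \<phi> \<Longrightarrow> Q1 p \<sigma> \<psi> \<phi> \<le> ennreal K13 * Q3 R p \<sigma> \<psi> \<phi>"
      using Q1_le_Q3[OF p R] by blast
    have "Q1 p \<sigma> \<psi> \<phi> \<le> ennreal (K13 * K32) * Q2 \<alpha> t p \<sigma> \<psi> \<phi>" if H: "?H \<psi> \<phi>" for \<psi> \<phi>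
    proof -
      have "Q1 p \<sigma> \<psi> \<phi> \<le> ennreal K13 * (ennreal K32 * Q2 \<alpha> t p \<sigma> \<psi> \<phi>)"
        using K13(2)[OF H] K32(2)[OF H] by (meson mult_left_mono order_trans zero_le)
      then show ?thesis using K13(1) by (simp add: ennreal_mult' mult.assoc)
    qed
    moreover have "Q3 R p \<sigma> \<psi> \<phi> \<le> ennreal (K32 * K21) * Q1 p \<sigma> \<psi> \<phi>" if H: "?H \<psi> \<phi>" for \<psi> \<phi>
    proof -
      have "Q3 R p \<sigma> \<psi> \<phi> \<le> ennreal K32 * (ennreal K21 * Q1 p \<sigma> \<psi> \<phi>)"
        using K32(2)[OF H] K21(2)[OF H] by (meson mult_left_mono order_trans zero_le)
      then show ?thesis using K32(1) by (simp add: ennreal_mult' mult.assoc)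
    qed
    ultimately show ?thesis
      using uniformly_comparableI[of "K13 * K32" K21 ?H "Q1 p \<sigma>" "Q2 \<alpha> t p \<sigma>"]
        uniformly_comparableI[of K13 "K32 * K21" ?H "Q1 p \<sigma>" "Q3 R p \<sigma>"] K13 K32 K21 by simp
  qed
  then have c12: "uniformly_comparable ?H (Q1 p \<sigma>) (Q2 \<alpha> t p \<sigma>)" using c12_c13[of "1 / 2"] by simp
  have c13: "uniformly_comparable ?H (Q1 p \<sigma>) (Q3 R p \<sigma>)" if "R \<in> {0<..<1}" for R
    using c12_c13[OF that] ..
  have c14: "uniformly_comparable ?H (Q1 p \<sigma>) (Q4 r z p \<sigma>)" if r: "r \<in> {0<..<1}" and lat: "is_lattice r z" for r z
  proof -
    obtain K where K: "K > 0" "\<And>\<psi> \<phi>. ?H \<psi> \<phi> \<Longrightarrow> Q1 p \<sigma> \<psi> \<phi> \<le> ennreal K * Q4 r z p \<sigma> \<psi> \<phi>"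
      using Q1_le_Q4[OF p r lat] by blast
    obtain L where L: "L > 0"
      "\<And>\<psi> \<phi> z. ?H \<psi> \<phi> \<Longrightarrow> is_lattice r z \<Longrightarrow> Q4 r z p \<sigma> \<psi> \<phi> \<le> ennreal L * Q1 p \<sigma> \<psi> \<phi>"
      using Q4_le_Q1[OF p r] by blast
    show ?thesis by (rule uniformly_comparableI[OF K(1) L(1) K(2) L(2)[OF _ lat]])
  qed
  have half: "1 / 2 \<in> {0<..<1::real}" by simp
  have equivalences:
    "(Q1 p \<sigma> \<psi> \<phi> < \<infinity> \<longleftrightarrow> Q2 \<alpha> t p \<sigma> \<psi> \<phi> < \<infinity>) \<and>
     (Q1 p \<sigma> \<psi> \<phi> < \<infinity> \<longleftrightarrow> (\<exists>R\<in>{0<..<1}. Q3 R p \<sigma> \<psi> \<phi> < \<infinity>)) \<and>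
     (Q1 p \<sigma> \<psi> \<phi> < \<infinity> \<longleftrightarrow> (\<forall>R\<in>{0<..<1}. Q3 R p \<sigma> \<psi> \<phi> < \<infinity>)) \<and>
     (\<forall>r\<in>{0<..<1}.
        (Q1 p \<sigma> \<psi> \<phi> < \<infinity> \<longleftrightarrow> (\<exists>z. is_lattice r z \<and> Q4 r z p \<sigma> \<psi> \<phi> < \<infinity>)) \<and>
        (Q1 p \<sigma> \<psi> \<phi> < \<infinity> \<longleftrightarrow> (\<forall>z. is_lattice r z \<longrightarrow> Q4 r z p \<sigma> \<psi> \<phi> < \<infinity>)))"
    if H: "?H \<psi> \<phi>" for \<psi> \<phi>
  proof -
    have "Q1 p \<sigma> \<psi> \<phi> < \<infinity> \<longleftrightarrow> Q2 \<alpha> t p \<sigma> \<psi> \<phi> < \<infinity>"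
      by (rule uniformly_comparable_finite_iff[OF c12, OF H])
    moreover have "Q1 p \<sigma> \<psi> \<phi> < \<infinity> \<longleftrightarrow> Q3 R p \<sigma> \<psi> \<phi> < \<infinity>" if "R \<in> {0<..<1}" for R
      by (rule uniformly_comparable_finite_iff[OF c13[OF that], OF H])
    moreover have "Q1 p \<sigma> \<psi> \<phi> < \<infinity> \<longleftrightarrow> Q4 r z p \<sigma> \<psi> \<phi> < \<infinity>" if "r \<in> {0<..<1}" "is_lattice r z" for r z
      by (rule uniformly_comparable_finite_iff[OF c14[OF that], OF H])
    ultimately show ?thesis using half exists_lattice by blast
  qed
  have c23: "uniformly_comparable ?H (Q2 \<alpha> t p \<sigma>) (Q3 R p \<sigma>)" if "R \<in> {0<..<1}" for R
    by (rule uniformly_comparable_trans[OF uniformly_comparable_sym[OF c12] c13[OF that]])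
  have c34: "uniformly_comparable ?H (Q3 R p \<sigma>) (Q4 r z p \<sigma>)"
    if "R \<in> {0<..<1}" "r \<in> {0<..<1}" "is_lattice r z" for R r z
    by (rule uniformly_comparable_trans[OF uniformly_comparable_sym[OF c13[OF that(1)]] c14[OF that(2,3)]])
  show ?thesis using equivalences c12 c23 c34 by blast
qed

end
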